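(* Let $2\le\alpha\le \frac73$ and $0<\delta<1$. Then for every $t\ge 0$, $$D_{\alpha\delta,\,1-\delta}(t)\ \ge\ \delta\, D_{\alpha,0}(t)+(1-\delta)\left(1-\frac89\delta\right).$$ In particular, nonnegativity of $D_{\alpha,0}$ on $[0,\infty)$ implies strict positivity of $D_{\alpha\delta,1-\delta}$ on $[0,\infty)$.
   Context: For $a>0$, $0\le c<1$, $a+c<3$, put $$w_{a,c}(s)=\frac1\pi\left(\frac{s}{1-s}\right)^{as+c}\sin\bigl(\pi(as+c)\bigr)\quad(0<s<1),$$ $$q_1=\frac a2+c,\qquad q_2=\frac a3+\frac c2+\frac12\left(\frac a2+c\right)^2,$$ $$D_{a,c}(t)=q_1+(q_1-q_2)t+e^{-a}\int_0^1 w_{a,c}(s)\bigl[e^{(1-s)t}-1-(1-s)t\bigr]\,ds .$$ *)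

theory Defs
  imports "HOL-Analysis.Analysis"
begin

(* The parameters a, c are meant to satisfy 0 < a, 0 \<le> c < 1, a + c < 3. *)

definition w :: "real \<Rightarrow> real \<Rightarrow> real \<Rightarrow> real" where
  "w a c s = 1 / pi * (s / (1 - s)) powr (a * s + c) * sin (pi * (a * s + c))"

definition q1 :: "real \<Rightarrow> real \<Rightarrow> real" where
  "q1 a c = a / 2 + c"

definition q2 :: "real \<Rightarrow> real \<Rightarrow> real" where
  "q2 a c = a / 3 + c / 2 + 1 / 2 * (a / 2 + c)\<^sup>2"

(* Lebesgue integral over (0,1). As s tends to 1, w a c s = O((1 - s) powr -(a + c)) while the
   bracket is O((1 - s)^2), so a + c < 3 makes the integrand absolutely integrable and the
   default value 0 of the Lebesgue integral for non-integrable functions does not arise. *)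
definition D :: "real \<Rightarrow> real \<Rightarrow> real \<Rightarrow> real" where
  "D a c t = q1 a c + (q1 a c - q2 a c) * t
     + exp (- a) * (LBINT s:{0<..<1}. w a c s * (exp ((1 - s) * t) - 1 - (1 - s) * t))"

end

theory Submission
  imports Defs "HOL-Complex_Analysis.Complex_Analysis"
begin

text \<open>
  Put \<open>u = 1 - s\<close>. Up to its constant and linear terms, the difference
  \<open>D (\<alpha> * \<delta>) (1 - \<delta>) t - \<delta> * D \<alpha> 0 t\<close> is the integral of \<open>exp (u * t) - 1 - u * t\<close> against one signed
  density, the \<open>density_gap\<close>. The constant term of the difference is \<open>1 - \<delta>\<close> and the linear one is
  nonnegative, so the task is to bound that integral below by \<open>- 8/9 * \<delta> * (1 - \<delta>)\<close>.

  The density gap changes sign only once, at \<open>s = 1 / \<alpha>\<close>: it is nonnegative before and nonpositive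
  after that point (\<open>density_gap_nonneg\<close>, \<open>density_gap_nonpos\<close>). The main reason is the log-concavity
  of \<open>sin x / x\<close>. Since \<open>(exp x - 1 - x - x\<^sup>2 / 2) / x ^ 3\<close> is increasing, replacing
  \<open>exp (u * t) - 1 - u * t\<close> by the function \<open>(t * u)\<^sup>2 / 2 + C * u ^ 3\<close> that agrees with it at the sign
  change can only decrease the integral (\<open>density_gap_mult_exp_tail_ge\<close>). Only the moments of \<open>u\<^sup>2\<close> and \<open>u ^ 3\<close>
  remain.

  These moments are known exactly. Up to a constant factor, the weight \<open>w a c\<close> is the jump across its
  cut of \<open>(1 + y) powr (a + c + a / y)\<close> with \<open>y = - 1 / u\<close>. By the residue theorem the
  moments are therefore, again up to constant factors, its Taylor coefficients at \<open>y = 0\<close>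
  (\<open>second_moment\<close>, \<open>third_moment\<close>). The contour is a rectangle in the coordinate
  \<open>z = ln (1 + y)\<close>, where the two sides of the cut are horizontal lines. For the density gap both
  moments are \<open>\<delta> * (1 - \<delta>)\<close> times polynomials in \<open>\<alpha>\<close> and
  \<open>\<delta>\<close>: the second is at worst slightly negative, and the third is positive for \<open>2 \<le>
  \<alpha> \<le> 7/3\<close>. Because \<open>C\<close> grows at least like \<open>t ^ 4\<close>, an elementary
  quartic inequality finishes the proof.
\<close>

section \<open>Log-concavity of the cardinal sine\<close>

text \<open>The expression is \<open>y\<^sup>2\<close> times the derivative of the chord slope \<open>ln (sin y / y) / y\<close>. After the
bound \<open>ln q \<le> q - 1\<close> its sign reduces to \<open>y / 2 \<le> tan (y / 2)\<close>.\<close>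

lemma sinc_log_slope_nonpos:
  fixes y :: real
  assumes "0 < y" "y < pi"
  shows "y * (cos y / sin y - 1 / y) - ln (sin y / y) \<le> 0"
proof -
  have s: "sin y > 0" using assms by (simp add: sin_gt_zero)
  have "ln (y / sin y) \<le> y / sin y - 1"
    using s assms by (intro ln_le_minus_one) auto
  moreover have "ln (y / sin y) = - ln (sin y / y)"
    using s assms by (simp add: ln_div)
  moreover have "y * (1 + cos y) \<le> 2 * sin y"
  proof -
    define x where "x = y / 2"
    have x: "0 < x" "x < pi/2" "y = 2 * x" using assms by (auto simp: x_def)
    have c: "cos x > 0" using x by (intro cos_gt_zero) auto
    have "x \<le> tan x"
    proof -
      have "\<exists>z::real. z > 0 \<and> z < x \<and> tan x - tan 0 = (x - 0) * inverse ((cos z)\<^sup>2)"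
        using x by (intro MVT2) (auto intro!: DERIV_tan cos_gt_zero_pi less_imp_neq[symmetric])
      then obtain z where z: "0 < z" "z < x" "tan x = x * inverse ((cos z)\<^sup>2)" by auto
      have "cos z > 0" using z x by (intro cos_gt_zero) auto
      moreover have "(cos z)\<^sup>2 \<le> 1" by (simp add: abs_square_le_1)
      ultimately have "1 \<le> inverse ((cos z)\<^sup>2)" by (simp add: one_le_inverse)
      then show ?thesis using z x by (simp add: mult_le_cancel_left1)
    qed
    then have "x * cos x \<le> sin x" using c by (simp add: tan_def pos_le_divide_eq)
    then have "2 * (2 * cos x) * (x * cos x) \<le> 2 * (2 * cos x) * sin x"
      using c by (intro mult_left_mono) auto
    then show ?thesis
      unfolding x(3) sin_double cos_double_cos by (simp add: power2_eq_square algebra_simps)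
  qed
  then have "y * (cos y / sin y) - 1 \<le> 1 - y / sin y"
    using s by (simp add: divide_simps) (simp add: algebra_simps)
  moreover have "y * (cos y / sin y - 1 / y) = y * (cos y / sin y) - 1"
    using assms by (simp add: right_diff_distrib)
  ultimately show ?thesis by linarith
qed

text \<open>Raising to a power \<open>\<delta>\<close> is dominated by scaling the argument because \<open>ln (sin y / y)\<close> is
concave and vanishes at \<open>0\<close>; equivalently, the slope \<open>ln (sin y / y) / y\<close> of the chord from the
origin decreases.\<close>

lemma sinc_powr_le:
  fixes x \<delta> :: real
  assumes "0 < x" "x < pi" "0 < \<delta>" "\<delta> < 1"
  shows "(sin x / x) powr \<delta> \<le> sin (\<delta> * x) / (\<delta> * x)"
proof -
  define \<phi> where "\<phi> y = ln (sin y / y) / y" for y :: real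
  have dx: "0 < \<delta> * x" "\<delta> * x < x"
    using assms by auto
  have "\<phi> x \<le> \<phi> (\<delta> * x)"
  proof (rule DERIV_nonpos_imp_nonincreasing[of "\<delta> * x" x \<phi>])
    show "\<delta> * x \<le> x" using dx(2) by (rule less_imp_le)
    fix y assume y: "\<delta> * x \<le> y" "y \<le> x"
    then have y': "0 < y" "y < pi" using dx(1) assms(2) by linarith+
    then have s: "sin y > 0" by (simp add: sin_gt_zero)
    have "(\<phi> has_real_derivative (y * (cos y / sin y - 1 / y) - ln (sin y / y)) / y\<^sup>2) (at y)"
      unfolding \<phi>_def using s y'
      by (auto intro!: derivative_eq_intros simp: divide_simps power2_eq_square) 
    then show "\<exists>d. (\<phi> has_real_derivative d) (at y) \<and> d \<le> 0"
      using sinc_log_slope_nonpos[OF y'] by (intro exI conjI) (auto simp: divide_le_0_iff)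
  qed
  then have "\<delta> * ln (sin x / x) \<le> ln (sin (\<delta> * x) / (\<delta> * x))"
    using assms dx by (simp add: \<phi>_def field_simps)
  moreover have "0 < sin x / x" "0 < sin (\<delta> * x) / (\<delta> * x)"
    using assms dx by (auto intro!: divide_pos_pos sin_gt_zero)
  ultimately show ?thesis
    by (simp add: powr_def ln_ge_iff)
qed

text \<open>As a function of \<open>\<delta>\<close>, the quotient \<open>X powr \<delta> * sin (\<delta> * x) / \<delta>\<close> is log-concave and tends to \<open>x\<close> as
\<open>\<delta>\<close> tends to \<open>0\<close>. So it stays above its value \<open>X * sin x\<close> at \<open>\<delta> = 1\<close> as soon as \<open>x\<close> does.\<close>

lemma powr_sin_ge:
  fixes x X \<delta> :: real
  assumes "0 < x" "x < pi" "0 < \<delta>" "\<delta> < 1" "0 < X" "X * sin x \<le> x"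
  shows "\<delta> * (X * sin x) \<le> X powr \<delta> * sin (\<delta> * x)"
proof -
  define q where "q = X * (sin x / x)"
  have s: "sin x > 0" using assms by (simp add: sin_gt_zero)
  have q: "0 < q" "q \<le> 1" using assms s by (auto simp: q_def)
  have "q \<le> q powr \<delta>"
    using q assms powr_mono_both'[of \<delta> 1 q q] by simp
  also have "\<dots> = X powr \<delta> * (sin x / x) powr \<delta>"
    unfolding q_def using assms s by (intro powr_mult) 
  also have "\<dots> \<le> X powr \<delta> * (sin (\<delta> * x) / (\<delta> * x))"
    using assms by (intro mult_left_mono sinc_powr_le) auto
  finally have "\<delta> * x * q \<le> \<delta> * x * (X powr \<delta> * (sin (\<delta> * x) / (\<delta> * x)))"
    using assms by (intro mult_left_mono) auto
  then show ?thesis using assms by (simp add: q_def)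
qed

section \<open>The single sign change of the density gap\<close>

text \<open>The density that remains when \<open>\<delta>\<close> times the integral term of \<open>D \<alpha> 0\<close> is subtracted from that of
\<open>D (\<alpha> * \<delta>) (1 - \<delta>)\<close>.\<close>

definition density_gap :: "real \<Rightarrow> real \<Rightarrow> real \<Rightarrow> real" where
  "density_gap \<alpha> \<delta> s = exp (- (\<alpha> * \<delta>)) * w (\<alpha> * \<delta>) (1 - \<delta>) s - \<delta> * (exp (- \<alpha>) * w \<alpha> 0 s)"

text \<open>The exponent of the first weight is \<open>\<alpha> * \<delta> * s + (1 - \<delta>) = 1 - \<delta> * \<theta>\<close>, so both weights are powers
of one base \<open>X\<close>, and the reflection \<open>sin (pi - x) = sin x\<close> puts the gap into the form treated
by \<open>powr_sin_ge\<close>.\<close>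

lemma density_gap_eq:
  fixes \<alpha> \<delta> s :: real
  assumes "0 < s" "s < 1"
  defines "\<theta> \<equiv> 1 - \<alpha> * s" and "R \<equiv> s / (1 - s)"
  defines "X \<equiv> exp (- \<alpha>) * R powr (- \<theta>)"
  shows "density_gap \<alpha> \<delta> s = R / pi * (X powr \<delta> * sin (\<delta> * (pi * \<theta>)) - \<delta> * (X * sin (pi * \<theta>)))"
proof -
  have R: "R > 0" using assms by (simp add: R_def)
  have 1: "R powr (\<alpha> * \<delta> * s + (1 - \<delta>)) * exp (- (\<alpha> * \<delta>)) = R * X powr \<delta>"
  proof -
    have "X powr \<delta> = exp (- (\<alpha> * \<delta>)) * R powr (- \<theta> * \<delta>)"
      unfolding X_def using R by (simp add: powr_mult powr_powr exp_powr_real)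
    moreover have "R powr (\<alpha> * \<delta> * s + (1 - \<delta>)) = R powr 1 * R powr (- \<theta> * \<delta>)"
      unfolding powr_add[symmetric] by (simp add: \<theta>_def algebra_simps)
    ultimately show ?thesis using R by simp
  qed
  have 2: "R powr (\<alpha> * s + 0) * exp (- \<alpha>) = R * X"
  proof -
    have "R powr (\<alpha> * s + 0) = R powr 1 * R powr (- \<theta>)"
      unfolding powr_add[symmetric] by (simp add: \<theta>_def)
    then show ?thesis using R by (simp add: X_def)
  qed
  have 3: "sin (pi * (\<alpha> * \<delta> * s + (1 - \<delta>))) = sin (\<delta> * (pi * \<theta>))"
  proof -
    have "pi * (\<alpha> * \<delta> * s + (1 - \<delta>)) = pi - \<delta> * (pi * \<theta>)" by (simp add: \<theta>_def algebra_simps)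
    then show ?thesis by simp
  qed
  have 4: "sin (pi * (\<alpha> * s + 0)) = sin (pi * \<theta>)"
  proof -
    have "pi * (\<alpha> * s + 0) = pi - pi * \<theta>" by (simp add: \<theta>_def algebra_simps)
    then show ?thesis by simp
  qed
  have "density_gap \<alpha> \<delta> s = 1 / pi * ((R powr (\<alpha> * \<delta> * s + (1 - \<delta>)) * exp (- (\<alpha> * \<delta>))) * sin (pi * (\<alpha> * \<delta> * s + (1 - \<delta>)))
      - \<delta> * (R powr (\<alpha> * s + 0) * exp (- \<alpha>)) * sin (pi * (\<alpha> * s + 0)))"
    unfolding density_gap_def w_def R_def[symmetric] by (simp add: algebra_simps)
  then show ?thesis unfolding 1 2 3 4 by (simp add: algebra_simps)
qed

lemma sin_pi_le:
  assumes "0 \<le> x" "x \<le> 1"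
  shows "sin (pi * x) \<le> pi * x" "sin (pi * x) \<le> pi * (1 - x)"
proof -
  show "sin (pi * x) \<le> pi * x" using assms by (intro sin_x_le_x) auto
  have "sin (pi * x) = sin (pi * (1 - x))" by (simp add: algebra_simps)
  then show "sin (pi * x) \<le> pi * (1 - x)"
    using assms sin_x_le_x[of "pi * (1 - x)"] by simp
qed

lemma exp_neg_le:
  fixes \<alpha> :: real
  assumes "2 \<le> \<alpha>"
  shows "exp (- \<alpha>) \<le> 1 / 5"
proof -
  have "exp (- \<alpha>) \<le> exp (- 2)" using assms by simp
  also have "\<dots> \<le> 1 / 5"
    using exp_lower_Taylor_quadratic[of "2::real"] by (simp add: exp_minus field_simps)
  finally show ?thesis .
qed

text \<open>Of the two estimates \<open>sin (pi * \<theta>) \<le> pi * \<theta>\<close> and \<open>sin (pi * \<theta>) \<le> pi * (1 - \<theta>)\<close>, the first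
suffices while \<open>s\<close> is not small. For small \<open>s\<close> the power is at most \<open>1 / s\<close>, and the second
estimate supplies the factor \<open>1 - \<theta> = \<alpha> * s\<close> that cancels it.\<close>

lemma base_sin_le_left:
  fixes \<alpha> s :: real
  assumes "2 \<le> \<alpha>" "\<alpha> \<le> 7/3" "0 < s" "s \<le> 1 / \<alpha>"
  defines "\<theta> \<equiv> 1 - \<alpha> * s"
  shows "exp (- \<alpha>) * (s / (1 - s)) powr (- \<theta>) * sin (pi * \<theta>) \<le> pi * \<theta>"
proof -
  define Q where "Q = (1 - s) / s"
  have "\<alpha> * s \<le> 1" using assms by (simp add: field_simps)
  moreover have "2 * s \<le> \<alpha> * s" using assms by simp
  ultimately have s1: "s \<le> 1/2" by simp
  have Q: "Q > 0" "Q \<le> 1 / s" using assms s1 by (auto simp: Q_def field_simps)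
  have \<theta>: "0 \<le> \<theta>" "\<theta> < 1" using assms \<open>\<alpha> * s \<le> 1\<close> by (auto simp: \<theta>_def)
  have eq: "(s / (1 - s)) powr (- \<theta>) = Q powr \<theta>"
    unfolding Q_def powr_divide powr_minus_divide by simp
  have ea: "exp (- \<alpha>) \<le> 1 / 5" using assms(1) by (rule exp_neg_le)
  have s0: "0 \<le> sin (pi * \<theta>)" using \<theta> by (intro sin_ge_zero) auto
  show ?thesis
  proof (cases "\<theta> \<le> 1/2")
    case True
    have "1 \<le> 2 * (\<alpha> * s)" using True by (simp add: \<theta>_def)
    also have "\<dots> \<le> 2 * (7/3 * s)" using assms by simp
    finally have "Q \<le> 4" using assms by (simp add: Q_def field_simps)
    then have "Q powr \<theta> \<le> 4 powr \<theta>" using Q \<theta> by (intro powr_mono2) auto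
    also have "\<dots> \<le> 4 powr 1" using True by (intro powr_mono) auto
    finally have "exp (-\<alpha>) * Q powr \<theta> \<le> 1/5 * 4" using ea by (intro mult_mono) auto
    then have "exp (-\<alpha>) * Q powr \<theta> * sin (pi * \<theta>) \<le> 1 * sin (pi * \<theta>)"
      using s0 by (intro mult_right_mono) auto
    also have "\<dots> \<le> pi * \<theta>" using sin_pi_le(1) \<theta> by simp
    finally show ?thesis unfolding eq .
  next
    case False
    have "Q powr \<theta> \<le> (1 / s) powr \<theta>" using Q \<theta> by (intro powr_mono2) auto
    also have "\<dots> \<le> (1 / s) powr 1" using \<theta> s1 assms by (intro powr_mono) auto
    finally have "Q powr \<theta> \<le> 1 / s" using assms by simp
    then have "exp (-\<alpha>) * Q powr \<theta> * sin (pi * \<theta>) \<le> 1/5 * (1/s) * (pi * (1 - \<theta>))"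
      using ea s0 sin_pi_le(2)[of \<theta>] \<theta> assms by (intro mult_mono) auto
    also have "\<dots> = pi * (\<alpha> / 5)" using assms by (simp add: \<theta>_def)
    also have "\<dots> \<le> pi * \<theta>" using False assms by (intro mult_left_mono) auto
    finally show ?thesis unfolding eq .
  qed
qed

text \<open>The mirror image of \<open>base_sin_le_left\<close>: the power is now at most \<open>2 / (1 - \<eta>)\<close>, and
\<open>sin (pi * \<eta>) \<le> pi * (1 - \<eta>)\<close> cancels the pole.\<close>

lemma base_sin_le_right:
  fixes \<alpha> s :: real
  assumes "2 \<le> \<alpha>" "\<alpha> \<le> 7/3" "0 < s" "s < 1" "1 / \<alpha> \<le> s"
  defines "\<eta> \<equiv> \<alpha> * s - 1"
  assumes \<eta>1: "\<eta> < 1"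
  shows "exp (- \<alpha>) * (s / (1 - s)) powr \<eta> * sin (pi * \<eta>) \<le> pi * \<eta>"
proof -
  define Q where "Q = s / (1 - s)"
  have as: "\<alpha> * s \<ge> 1" using assms by (simp add: field_simps)
  have Q: "Q > 0" using assms by (auto simp: Q_def)
  have \<eta>: "0 \<le> \<eta>" using as by (auto simp: \<eta>_def)
  have ea: "exp (- \<alpha>) \<le> 1 / 5" using assms(1) by (rule exp_neg_le)
  have s0: "0 \<le> sin (pi * \<eta>)" using \<eta> \<eta>1 by (intro sin_ge_zero) auto
  show ?thesis
  proof (cases "\<eta> \<le> 1/2")
    case True
    have "2 * s \<le> \<alpha> * s" using assms by simp
    then have "s \<le> 3/4" using True unfolding \<eta>_def by linarith
    then have "Q \<le> 4" using assms by (simp add: Q_def field_simps)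
    then have "Q powr \<eta> \<le> 4 powr \<eta>" using Q \<eta> by (intro powr_mono2) auto
    also have "\<dots> \<le> 4 powr 1" using True by (intro powr_mono) auto
    finally have "exp (-\<alpha>) * Q powr \<eta> \<le> 1/5 * 4" using ea by (intro mult_mono) auto
    then have "exp (-\<alpha>) * Q powr \<eta> * sin (pi * \<eta>) \<le> 1 * sin (pi * \<eta>)"
      using s0 by (intro mult_right_mono) auto
    also have "\<dots> \<le> pi * \<eta>" using sin_pi_le(1) \<eta> \<eta>1 by simp
    finally show ?thesis unfolding Q_def .
  next
    case False
    have "2 * s \<le> \<alpha> * s" using assms by simp
    then have "1 - \<eta> \<le> 2 * (1 - s)" by (simp add: \<eta>_def)
    then have "1 / (1 - s) \<le> 2 / (1 - \<eta>)" using \<eta>1 assms by (simp add: field_simps)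
    moreover have "Q \<le> 1 / (1 - s)" unfolding Q_def using assms by (intro divide_right_mono) auto
    ultimately have "Q \<le> 2 / (1 - \<eta>)" by simp
    then have "Q powr \<eta> \<le> (2 / (1 - \<eta>)) powr \<eta>" using Q \<eta> by (intro powr_mono2) auto
    also have "\<dots> \<le> (2 / (1 - \<eta>)) powr 1" using \<eta> \<eta>1 by (intro powr_mono) auto
    finally have "Q powr \<eta> \<le> 2 / (1 - \<eta>)" using \<eta>1 by simp
    then have "exp (-\<alpha>) * Q powr \<eta> * sin (pi * \<eta>) \<le> 1/5 * (2 / (1 - \<eta>)) * (pi * (1 - \<eta>))"
      using ea s0 sin_pi_le(2)[of \<eta>] \<eta> \<eta>1 by (intro mult_mono) auto
    also have "\<dots> = pi * (2/5)" using \<eta>1 by (simp add: divide_simps)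
    also have "\<dots> \<le> pi * \<eta>" using False by (intro mult_left_mono) auto
    finally show ?thesis unfolding Q_def .
  qed
qed

lemma ln_six_ge: "ln (6::real) \<ge> 5/3"
proof -
  have "exp (5::real) = exp 1 ^ 5" by (simp add: exp_of_nat_mult[symmetric])
  also have "\<dots> \<le> (272/100) ^ 5" using e_less_272 by (intro power_mono) auto
  also have "\<dots> \<le> (6::real) ^ 3" by (simp add: power_divide)
  finally have "5 \<le> ln ((6::real) ^ 3)" by (simp add: ln_ge_iff)
  then have "5 \<le> 3 * ln (6::real)" by (simp only: ln_realpow)
  then show ?thesis by simp
qed

text \<open>For \<open>\<eta> \<ge> 1\<close> the sine on the left is nonpositive and \<open>powr_sin_ge\<close> does not apply. The delicate case
is \<open>\<delta> * \<eta> > 1\<close>, where both sines are negative. The first-order term in \<open>1 - \<delta>\<close>, bounded by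
the tangent of the sine at \<open>\<eta>\<close>, then outweighs the possible loss from \<open>Y < 1\<close>.\<close>

lemma sin_powr_past_period:
  fixes \<delta> \<eta> Y :: real
  assumes "0 < \<delta>" "\<delta> < 1" "1 \<le> \<eta>" "\<eta> \<le> 4/3" "0 < Y" "ln Y \<ge> - 2/3"
  shows "\<delta> * (Y * sin (pi * \<eta>)) \<le> Y powr \<delta> * sin (\<delta> * (pi * \<eta>))"
proof (cases "\<delta> * \<eta> \<le> 1")
  case True
  then have "0 \<le> sin (\<delta> * (pi * \<eta>))"
    using assms by (intro sin_ge_zero) (auto simp: mult.left_commute)
  moreover have "sin (pi * \<eta>) \<le> 0"
    using assms by (intro sin_le_zero) (auto simp: mult_le_cancel_left)
  ultimately have "\<delta> * (Y * sin (pi * \<eta>)) \<le> 0" "0 \<le> Y powr \<delta> * sin (\<delta> * (pi * \<eta>))"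
    using assms by (auto simp: mult_le_0_iff)
  then show ?thesis by linarith
next
  case False
  define r where "r = pi * (\<eta> - 1)"
  define p where "p = pi * (\<delta> * \<eta> - 1)"
  define \<epsilon> where "\<epsilon> = 1 - \<delta>"
  have e: "0 < \<epsilon>" "\<epsilon> < 1" using assms by (auto simp: \<epsilon>_def)
  have pr: "0 < p" "p < r" "r \<le> pi / 3" "r - p = pi * (\<epsilon> * \<eta>)"
    using assms False by (auto simp: p_def r_def \<epsilon>_def algebra_simps)
  have sr: "sin (pi * \<eta>) = - sin r"
    by (simp add: r_def right_diff_distrib sin_diff)
  have sp: "sin (\<delta> * (pi * \<eta>)) = - sin p"
    by (simp add: p_def right_diff_distrib sin_diff mult.left_commute)
  have sr0: "0 \<le> sin r" using pr pi_gt_zero by (intro sin_ge_zero) auto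
  have cr: "1/2 \<le> cos r"
    using cos_monotone_0_pi_le[of r "pi/3"] pr by (simp add: cos_60)
  \<comment> \<open>With this bound the factor 5/3 = 1 + 2/3 below is exactly compensated: 5/3 * 9/10 = 3/2.\<close>
  have srle: "sin r \<le> 9/10"
  proof -
    have "sin r \<le> sin (pi/3)" using pr by (intro sin_monotone_2pi_le) auto
    also have "\<dots> = sqrt 3 / 2" by (simp add: sin_60)
    also have "sqrt 3 \<le> 9/5" by (intro real_le_lsqrt) (auto simp: power2_eq_square)
    finally show ?thesis by simp
  qed
  \<comment> \<open>The tangent line of the concave sine at r dominates it at p.\<close>
  have tan: "sin p \<le> sin r - cos r * (r - p)"
  proof -
    obtain z where z: "p < z" "z < r" "sin r - sin p = (r - p) * cos z"
      using MVT2[of p r sin cos] pr by (auto intro: DERIV_sin)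
    have "cos r \<le> cos z" using z pr pi_gt_zero by (intro cos_monotone_0_pi_le) auto
    then have "cos r * (r - p) \<le> cos z * (r - p)" using pr by (intro mult_right_mono) auto
    then show ?thesis using z(3) by (simp add: mult.commute[of "r - p"])
  qed
  have "cos r * (r - p) \<ge> 1/2 * (3 * \<epsilon>)"
  proof -
    have "3 * \<epsilon> * 1 \<le> pi * \<epsilon> * \<eta>" using assms e pi_gt3 by (intro mult_mono) auto
    then show ?thesis using cr e pr(4) by (intro mult_mono) (auto simp: mult.assoc)
  qed
  then have "sin p \<le> sin r - 3/2 * \<epsilon>" using tan by simp
  also have "\<dots> \<le> sin r - 5/3 * \<epsilon> * sin r"
    using mult_left_mono[OF srle, of "5/3 * \<epsilon>"] e by (simp add: mult_ac)
  also have "\<dots> \<le> (1 - \<epsilon>) * (1 - 2/3 * \<epsilon>) * sin r"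
  proof -
    have "1 - 5/3 * \<epsilon> \<le> (1 - \<epsilon>) * (1 - 2/3 * \<epsilon>)" using e by (simp add: algebra_simps)
    from mult_right_mono[OF this sr0] show ?thesis by (simp add: algebra_simps)
  qed
  also have "\<dots> \<le> \<delta> * Y powr \<epsilon> * sin r"
  proof -
    have "1 - 2/3 * \<epsilon> \<le> 1 + \<epsilon> * ln Y"
      using mult_left_mono[OF assms(6), of \<epsilon>] e by simp
    also have "\<dots> \<le> Y powr \<epsilon>" using assms by (simp add: powr_def exp_ge_add_one_self)
    finally show ?thesis using sr0 assms
      by (intro mult_right_mono mult_mono) (auto simp: \<epsilon>_def)
  qed
  finally have "Y powr \<delta> * sin p \<le> Y powr \<delta> * (\<delta> * Y powr \<epsilon> * sin r)"
    by (intro mult_left_mono) auto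
  also have "\<dots> = \<delta> * (Y powr (\<delta> + \<epsilon>) * sin r)" by (simp add: powr_add)
  also have "Y powr (\<delta> + \<epsilon>) = Y" using assms by (simp add: \<epsilon>_def)
  finally show ?thesis unfolding sr sp by simp
qed

lemma density_gap_nonneg:
  assumes "2 \<le> \<alpha>" "\<alpha> \<le> 7/3" "0 < \<delta>" "\<delta> < 1" "0 < s" "s \<le> 1 / \<alpha>"
  shows "0 \<le> density_gap \<alpha> \<delta> s"
proof -
  define \<theta> where "\<theta> = 1 - \<alpha> * s"
  define X where "X = exp (- \<alpha>) * (s / (1 - s)) powr (- \<theta>)"
  have "1 / \<alpha> \<le> 1/2" using assms by (simp add: field_simps)
  then have s: "s < 1" using assms by linarith
  have \<theta>: "0 \<le> \<theta>" "\<theta> < 1" using assms by (auto simp: \<theta>_def field_simps)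
  have "\<delta> * (X * sin (pi * \<theta>)) \<le> X powr \<delta> * sin (\<delta> * (pi * \<theta>))"
  proof (cases "\<theta> = 0")
    case False
    then show ?thesis
      using powr_sin_ge[of "pi * \<theta>" \<delta> X] base_sin_le_left[of \<alpha> s] \<theta> assms s
      by (simp add: X_def \<theta>_def)
  qed simp
  then show ?thesis
    using density_gap_eq[of s \<alpha> \<delta>] assms s by (simp add: X_def \<theta>_def)
qed

text \<open>On this side \<open>\<theta> = - \<eta>\<close> is negative, so the inequalities between the sines act with the opposite
sign. For \<open>\<eta> \<ge> 1\<close> the point \<open>s\<close> lies in \<open>[6/7, 1)\<close>, which gives the lower bound for \<open>ln Y\<close>.\<close>

lemma density_gap_nonpos:
  assumes "2 \<le> \<alpha>" "\<alpha> \<le> 7/3" "0 < \<delta>" "\<delta> < 1" "1 / \<alpha> \<le> s" "s < 1"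
  shows "density_gap \<alpha> \<delta> s \<le> 0"
proof -
  define \<eta> where "\<eta> = \<alpha> * s - 1"
  define Y where "Y = exp (- \<alpha>) * (s / (1 - s)) powr \<eta>"
  have "0 < 1 / \<alpha>" using assms by simp
  then have s: "0 < s" using assms by linarith
  have \<eta>0: "0 \<le> \<eta>" using assms by (auto simp: \<eta>_def field_simps)
  have "\<alpha> * s \<le> 7/3 * 1" using assms s by (intro mult_mono) auto
  then have \<eta>2: "\<eta> \<le> 4/3" by (simp add: \<eta>_def)
  have Y: "Y > 0" using s assms by (simp add: Y_def)
  have "\<delta> * (Y * sin (pi * \<eta>)) \<le> Y powr \<delta> * sin (\<delta> * (pi * \<eta>))"
  proof (cases "\<eta> < 1")
    case True
    show ?thesis
    proof (cases "\<eta> = 0")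
      case False
      then show ?thesis
        using powr_sin_ge[of "pi * \<eta>" \<delta> Y] base_sin_le_right[of \<alpha> s] \<eta>0 True assms s Y
        by (simp add: Y_def \<eta>_def)
    qed simp
  next
    case False
    have "7/3 * s \<ge> \<alpha> * s" using assms s by simp
    then have "s \<ge> 6/7" using False by (simp add: \<eta>_def)
    then have R: "s / (1 - s) \<ge> 6" using assms by (simp add: field_simps)
    have "5/3 * 1 \<le> ln (s / (1 - s)) * \<eta>"
    proof (intro mult_mono)
      have "ln 6 \<le> ln (s / (1 - s))" using R by simp
      then show "5/3 \<le> ln (s / (1 - s))" using ln_six_ge by linarith
      then show "0 \<le> ln (s / (1 - s))" by simp
    qed (use False in auto)
    moreover have "ln Y = - \<alpha> + \<eta> * ln (s / (1 - s))"
      using s assms by (simp add: Y_def ln_mult ln_powr)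
    ultimately have "ln Y \<ge> - 2/3" using assms by (simp add: mult.commute)
    then show ?thesis using False \<eta>2 Y assms by (intro sin_powr_past_period) auto
  qed
  moreover have "1 - \<alpha> * s = - \<eta>" by (simp add: \<eta>_def)
  moreover have "0 \<le> s / (1 - s) / pi" using assms s by simp
  ultimately have "s / (1 - s) / pi * (\<delta> * (Y * sin (pi * \<eta>)) - Y powr \<delta> * sin (\<delta> * (pi * \<eta>))) \<le> 0"
    by (intro mult_nonneg_nonpos) auto
  then show ?thesis
    using density_gap_eq[of s \<alpha> \<delta>] assms s \<open>1 - \<alpha> * s = - \<eta>\<close> by (simp add: Y_def[symmetric])
qed

section \<open>Residues and Taylor coefficients\<close>

text \<open>The product of \<open>Y'\<close> with a power of \<open>Y\<close> has a primitive unless the exponent is \<open>-1\<close>.\<close>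

lemma fls_residue_deriv_divide_power:
  fixes Y :: "'a::field_char_0 fls"
  assumes "Y \<noteq> 0"
  shows "fls_residue (fls_deriv Y / Y ^ Suc n) = (if n = 0 then of_int (fls_subdegree Y) else 0)"
proof (cases "n = 0")
  case True
  then show ?thesis
    using fls_residue_deriv_times_inverse_eq_subdegree(1)[of Y] by (simp add: field_simps)
next
  case False
  have "fls_deriv (inverse Y ^ n) = of_nat n * inverse Y ^ (n - 1) * fls_deriv (inverse Y)"
    by (rule fls_deriv_power)
  also have "fls_deriv (inverse Y) = - fls_deriv Y * inverse Y ^ 2"
    by (rule fls_inverse_deriv)
  also have "of_nat n * inverse Y ^ (n - 1) * (- fls_deriv Y * inverse Y ^ 2)
      = of_int (- int n) * (fls_deriv Y / Y ^ Suc n)"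
    using False by (cases n) (simp_all add: divide_inverse power_inverse algebra_simps power2_eq_square)
  finally have "0 = of_int (- int n) * fls_residue (fls_deriv Y / Y ^ Suc n)"
    by (metis fls_residue_deriv fls_residue_of_int_times(1))
  then show ?thesis using False by simp
qed

text \<open>Residues are invariant under the change of variable \<open>Y\<close>: peeling off one coefficient of \<open>F\<close> at a
time reduces the claim to the powers of \<open>Y\<close>.\<close>

lemma fls_residue_compose_divide_power:
  fixes F Y :: "'a::field_char_0 fps"
  assumes Y: "fps_nth Y 0 = 0" "fps_nth Y 1 \<noteq> 0"
  shows "fls_residue (fps_to_fls (fps_deriv Y * (F oo Y)) / fps_to_fls Y ^ Suc n) = fps_nth F n"
proof (induction n arbitrary: F)
  case 0
  define G where "G = fps_shift 1 F"
  have sub: "subdegree Y = 1" using Y by (intro subdegreeI) auto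
  then have "Y \<noteq> 0" by auto
  have F: "F = fps_const (fps_nth F 0) + fps_X * G"
    unfolding G_def by (simp add: fps_eq_iff fps_X_mult_nth)
  have "F oo Y = fps_const (fps_nth F 0) + Y * (G oo Y)"
    using Y by (subst F) (simp add: fps_compose_add_distrib fps_compose_mult_distrib)
  then have "fps_to_fls (fps_deriv Y * (F oo Y)) / fps_to_fls Y ^ Suc 0
     = fls_const (fps_nth F 0) * (fls_deriv (fps_to_fls Y) / fps_to_fls Y ^ Suc 0) + fps_to_fls (fps_deriv Y * (G oo Y))"
    using \<open>Y \<noteq> 0\<close> by (simp add: fls_deriv_fps_to_fls fls_times_fps_to_fls field_simps)
  then have "fls_residue (fps_to_fls (fps_deriv Y * (F oo Y)) / fps_to_fls Y ^ Suc 0)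
     = fps_nth F 0 * fls_residue (fls_deriv (fps_to_fls Y) / fps_to_fls Y ^ Suc 0)
       + fls_residue (fps_to_fls (fps_deriv Y * (G oo Y)))"
    by (simp only: fls_residue_add fls_residue_fls_const_times)
  then show ?case
    using fls_residue_deriv_divide_power[of "fps_to_fls Y" 0] \<open>Y \<noteq> 0\<close> sub
    by (simp add: fls_subdegree_fls_to_fps)
next
  case (Suc n)
  define G where "G = fps_shift 1 F"
  have "Y \<noteq> 0" using Y by auto
  have F: "F = fps_const (fps_nth F 0) + fps_X * G"
    unfolding G_def by (simp add: fps_eq_iff fps_X_mult_nth)
  have "F oo Y = fps_const (fps_nth F 0) + Y * (G oo Y)"
    using Y by (subst F) (simp add: fps_compose_add_distrib fps_compose_mult_distrib)
  then have "fps_to_fls (fps_deriv Y * (F oo Y)) / fps_to_fls Y ^ Suc (Suc n)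
     = fls_const (fps_nth F 0) * (fls_deriv (fps_to_fls Y) / fps_to_fls Y ^ Suc (Suc n))
       + fps_to_fls (fps_deriv Y * (G oo Y)) / fps_to_fls Y ^ Suc n"
    using \<open>Y \<noteq> 0\<close> by (simp add: fls_deriv_fps_to_fls fls_times_fps_to_fls field_simps)
  then have "fls_residue (fps_to_fls (fps_deriv Y * (F oo Y)) / fps_to_fls Y ^ Suc (Suc n))
     = fps_nth F 0 * fls_residue (fls_deriv (fps_to_fls Y) / fps_to_fls Y ^ Suc (Suc n)) + fps_nth G n"
    by (simp only: fls_residue_add fls_residue_fls_const_times Suc.IH)
  then show ?case
    using fls_residue_deriv_divide_power[of "fps_to_fls Y" "Suc n"] \<open>Y \<noteq> 0\<close>
    by (simp add: G_def)
qed

lemma residue_exp_substitution: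
  assumes "f has_fps_expansion F"
  shows "residue (\<lambda>z. exp z * f (exp z - 1) / (exp z - 1) ^ Suc n) 0 = fps_nth F n"
proof -
  define Y :: "complex fps" where "Y = fps_exp 1 - 1"
  have Y: "fps_nth Y 0 = 0" "fps_nth Y 1 \<noteq> 0" by (auto simp: Y_def)
  have expY: "(\<lambda>z::complex. exp z - 1) has_fps_expansion Y"
    unfolding Y_def by (intro fps_expansion_intros)
  have "(\<lambda>z. exp z * (f \<circ> (\<lambda>z. exp z - 1)) z) has_fps_expansion fps_deriv Y * (F oo Y)"
    using has_fps_expansion_mult[OF has_fps_expansion_exp1
        has_fps_expansion_compose[OF assms expY Y(1)]]
    by (simp add: Y_def)
  then have "(\<lambda>z. exp z * (f \<circ> (\<lambda>z. exp z - 1)) z / (exp z - 1) ^ Suc n) has_laurent_expansion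
      fps_to_fls (fps_deriv Y * (F oo Y)) / fps_to_fls Y ^ Suc n"
    by (intro laurent_expansion_intros has_laurent_expansion_fps expY)
  from has_laurent_expansion_residue_0[OF this]
  show ?thesis using fls_residue_compose_divide_power[OF Y] by simp
qed

lemma has_fps_expansion_Ln: "(\<lambda>z. Ln (1 + z)) has_fps_expansion fps_ln 1"
proof (rule has_fps_expansionI)
  have "eventually (\<lambda>z::complex. z \<in> ball 0 1) (nhds 0)"
    by (intro eventually_nhds_in_open) auto
  then show "\<forall>\<^sub>F u in nhds 0. (\<lambda>n. fps_nth (fps_ln 1) n * u ^ n) sums Ln (1 + u)"
  proof eventually_elim
    case (elim u)
    then have "(\<lambda>n. (-1) ^ Suc n / of_nat n * u ^ n) sums Ln (1 + u)"
      using Ln_series[of u] by simp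
    then show ?case
    proof (rule sums_cong[THEN iffD1, rotated])
      show "(-1) ^ Suc n / of_nat n * u ^ n = fps_nth (fps_ln 1) n * u ^ n" for n
        by (cases n) (auto simp: fps_ln_nth)
    qed
  qed
qed

text \<open>The recursion is the differential equation \<open>E' = E * L'\<close> of \<open>E = exp L\<close>, read off coefficientwise.\<close>

lemma fps_nth_exp_compose:
  fixes L :: "'a::field_char_0 fps"
  assumes "fps_nth L 0 = 0"
  shows "fps_nth (fps_exp 1 oo L) 0 = 1"
    and "of_nat (Suc n) * fps_nth (fps_exp 1 oo L) (Suc n)
       = (\<Sum>i=0..n. fps_nth (fps_exp 1 oo L) i * (of_nat (Suc (n - i)) * fps_nth L (Suc (n - i))))"
proof -
  show "fps_nth (fps_exp 1 oo L) 0 = 1" by simp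
  have "fps_deriv (fps_exp 1 oo L) = (fps_exp 1 oo L) * fps_deriv L"
    by (simp add: fps_compose_deriv[OF assms])
  then have "fps_nth (fps_deriv (fps_exp 1 oo L)) n = fps_nth ((fps_exp 1 oo L) * fps_deriv L) n"
    by simp
  then show "of_nat (Suc n) * fps_nth (fps_exp 1 oo L) (Suc n)
       = (\<Sum>i=0..n. fps_nth (fps_exp 1 oo L) i * (of_nat (Suc (n - i)) * fps_nth L (Suc (n - i))))"
    by (simp add: fps_mult_nth)
qed

text \<open>For \<open>n \<ge> 1\<close> this is the coefficient of \<open>y ^ n\<close> in \<open>(a + c + a / y) * ln (1 + y)\<close>; the constant
coefficient there is \<open>a\<close>.\<close>

definition log_coeff :: "real \<Rightarrow> real \<Rightarrow> nat \<Rightarrow> real" where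
  "log_coeff a c n = (-1) ^ Suc n * ((a + c) / real n - a / real (Suc n))"

text \<open>The coefficients of \<open>y ^ 3\<close> and \<open>y ^ 4\<close> in \<open>exp (- a) * (1 + y) powr (a + c + a / y)\<close>.\<close>

definition taylor3 :: "real \<Rightarrow> real \<Rightarrow> real" where
  "taylor3 a c = (let l = log_coeff a c in l 3 + l 1 * l 2 + l 1 ^ 3 / 6)"

definition taylor4 :: "real \<Rightarrow> real \<Rightarrow> real" where
  "taylor4 a c = (let l = log_coeff a c in
     l 4 + l 1 * l 3 + l 2 ^ 2 / 2 + l 1 ^ 2 * l 2 / 2 + l 1 ^ 4 / 24)"

lemma fps_nth_exp_compose_3_4:
  fixes L :: "complex fps"
  assumes "fps_nth L 0 = 0" "\<And>n. n > 0 \<Longrightarrow> fps_nth L n = of_real (log_coeff a c n)"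
  shows "fps_nth (fps_exp 1 oo L) 3 = of_real (taylor3 a c)"
    and "fps_nth (fps_exp 1 oo L) 4 = of_real (taylor4 a c)"
proof -
  define l where "l n = complex_of_real (log_coeff a c n)" for n
  define e where "e = fps_nth (fps_exp 1 oo L)"
  have l: "fps_nth L (Suc n) = l (Suc n)" for n by (simp add: assms l_def)
  have e0: "e 0 = 1" unfolding e_def by (rule fps_nth_exp_compose(1)[OF assms(1)])
  have rec: "of_nat (Suc n) * e (Suc n) = (\<Sum>i=0..n. e i * (of_nat (Suc (n - i)) * l (Suc (n - i))))" for n
    unfolding e_def using fps_nth_exp_compose(2)[OF assms(1), of n] by (simp only: l)
  have e1: "e 1 = l 1" using rec[of 0] e0 by simp
  have "2 * e 2 = 2 * l 2 + l 1 * e 1"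
    using rec[of 1] e0 by (simp add: eval_nat_numeral algebra_simps)
  then have e2: "2 * e 2 = 2 * l 2 + l 1 ^ 2" using e1 by algebra
  have "3 * e 3 = 3 * l 3 + 2 * l 2 * e 1 + l 1 * e 2"
    using rec[of 2] e0 by (simp add: eval_nat_numeral algebra_simps)
  then have e3: "6 * e 3 = 6 * l 3 + 6 * l 1 * l 2 + l 1 ^ 3" using e1 e2 by algebra
  have "4 * e 4 = 4 * l 4 + 3 * l 3 * e 1 + 2 * l 2 * e 2 + l 1 * e 3"
    using rec[of 3] e0 by (simp add: eval_nat_numeral algebra_simps)
  then have e4: "24 * e 4 = 24 * l 4 + 24 * l 1 * l 3 + 12 * l 2 ^ 2 + 12 * l 1 ^ 2 * l 2 + l 1 ^ 4"
    using e1 e2 e3 by algebra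
  have "e 3 = l 3 + l 1 * l 2 + l 1 ^ 3 / 6" using e3 by (simp add: field_simps)
  then show "fps_nth (fps_exp 1 oo L) 3 = of_real (taylor3 a c)"
    by (simp add: e_def l_def taylor3_def Let_def)
  have "e 4 = l 4 + l 1 * l 3 + l 2 ^ 2 / 2 + l 1 ^ 2 * l 2 / 2 + l 1 ^ 4 / 24"
    using e4 by (simp add: field_simps)
  then show "fps_nth (fps_exp 1 oo L) 4 = of_real (taylor4 a c)"
    by (simp add: e_def l_def taylor4_def Let_def)
qed

text \<open>The function \<open>(1 + y) powr (a + c + a / y)\<close> in the coordinate \<open>z = ln (1 + y)\<close>. This coordinate
uniformises the logarithm: the two sides of the cut \<open>y < -1\<close> become the lines \<open>Im z = \<plusminus> pi\<close>.\<close>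

definition \<Phi> :: "real \<Rightarrow> real \<Rightarrow> complex \<Rightarrow> complex" where
  "\<Phi> a c z = exp (of_real (a + c) * z + of_real a * (z / (exp z - 1)))"

text \<open>Near \<open>0\<close> the logarithm inverts \<open>exp z - 1\<close>, so the residues are those of
\<open>(1 + y) powr (a + c + a / y) / y ^ Suc n\<close>, that is, Taylor coefficients.\<close>

lemma residue_\<Phi>:
  obtains E where "\<And>n. residue (\<lambda>z. exp z * \<Phi> a c z / (exp z - 1) ^ Suc n) 0 = of_real (exp a) * fps_nth E n"
    "fps_nth E 3 = of_real (taylor3 a c)" "fps_nth E 4 = of_real (taylor4 a c)"
proof -
  define L :: "complex fps" where
    "L = fps_const (of_real (a + c)) * fps_ln 1 + fps_const (of_real a) * (fps_shift 1 (fps_ln 1) - 1)"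
  have L0: "fps_nth L 0 = 0" by (simp add: L_def fps_ln_nth)
  have Ln: "fps_nth L n = of_real (log_coeff a c n)" if "n > 0" for n
    using that by (cases n) (simp_all add: L_def fps_ln_nth log_coeff_def algebra_simps del: of_nat_Suc)
  define q :: "complex \<Rightarrow> complex" where "q y = (if y = 0 then 1 else Ln (1 + y) / y ^ 1)" for y
  have sub: "subdegree (fps_ln (1::complex)) = 1" by (rule subdegreeI) (auto simp: fps_ln_nth)
  have q: "q has_fps_expansion fps_shift 1 (fps_ln 1)"
    unfolding q_def
    by (intro has_fps_expansion_shift has_fps_expansion_Ln)
       (simp_all add: fps_ln_nth sub)
  define g where "g y = of_real (a + c) * Ln (1 + y) + of_real a * (q y - 1)" for y
  have g: "g has_fps_expansion L"
    unfolding g_def L_def by (intro fps_expansion_intros has_fps_expansion_Ln q)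
  define f where "f y = of_real (exp a) * (exp \<circ> g) y" for y
  have f: "f has_fps_expansion fps_const (of_real (exp a)) * (fps_exp 1 oo L)"
    unfolding f_def
    by (intro fps_expansion_intros has_fps_expansion_compose g L0)
  have "residue (\<lambda>z. exp z * \<Phi> a c z / (exp z - 1) ^ Suc n) 0
     = residue (\<lambda>z. exp z * f (exp z - 1) / (exp z - 1) ^ Suc n) 0" for n
  proof (rule residue_cong)
    have "eventually (\<lambda>z::complex. z \<in> ball 0 1 - {0}) (at 0)"
      by (intro eventually_at_in_open) auto
    then show "\<forall>\<^sub>F z in at 0. exp z * \<Phi> a c z / (exp z - 1) ^ Suc n
         = exp z * f (exp z - 1) / (exp z - 1) ^ Suc n"
    proof eventually_elim
      case (elim z)
      have "\<bar>Im z\<bar> < 1" using elim abs_Im_le_cmod[of z] by simp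
      then have Ln: "Ln (exp z) = z" using pi_gt3 by (intro Ln_exp) auto
      have "exp z - 1 \<noteq> 0"
      proof
        assume "exp z - 1 = 0"
        then have "Ln (exp z) = 0" by simp
        then show False using Ln elim by simp
      qed
      then have "f (exp z - 1) = \<Phi> a c z"
        by (simp add: f_def g_def q_def Ln \<Phi>_def exp_of_real[symmetric] exp_add[symmetric] algebra_simps)
      then show ?case by simp
    qed
  qed simp
  also have "residue (\<lambda>z. exp z * f (exp z - 1) / (exp z - 1) ^ Suc n) 0
      = of_real (exp a) * fps_nth (fps_exp 1 oo L) n" for n
    using residue_exp_substitution[OF f, of n] by simp
  finally show ?thesis
    using that[of "fps_exp 1 oo L"] fps_nth_exp_compose_3_4[OF L0 Ln] by blast
qed

section \<open>Integrability of the weights\<close>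

lemma abs_w_le:
  assumes "0 < a" "0 \<le> c" "0 < s" "s < 1"
  shows "\<bar>w a c s\<bar> \<le> (1 - s) powr (- (a + c))"
proof -
  define p where "p = a * s + c"
  have "0 < a * s" "a * s \<le> a" using assms by auto
  then have p: "0 < p" "p \<le> a + c" using assms(2) unfolding p_def by linarith+
  have "\<bar>w a c s\<bar> = 1 / pi * (s / (1 - s)) powr p * \<bar>sin (pi * p)\<bar>"
    using assms by (simp add: w_def p_def abs_mult)
  also have "\<dots> \<le> 1 * (s / (1 - s)) powr p * 1"
    using pi_gt3 by (intro mult_mono) auto
  also have "\<dots> = s powr p * (1 - s) powr (- p)" by (simp add: powr_divide powr_minus_divide)
  also have "\<dots> \<le> 1 * (1 - s) powr (- (a + c))"
    using assms p by (intro mult_mono powr_le1 powr_mono') auto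
  finally show ?thesis by simp
qed

lemma borel_measurable_w [measurable]: "w a c \<in> borel_measurable borel"
  unfolding w_def by measurable

text \<open>Comparison with a Beta integrand: the weight has at worst the singularity \<open>(1 - s) powr (- (a + c))\<close>,
whose exponent exceeds \<open>-3\<close>, and a quadratic zero of \<open>g\<close> at \<open>1\<close> makes it integrable.\<close>

lemma set_integrable_w_mult:
  assumes "0 < a" "0 \<le> c" "a + c < 3" and [measurable]: "g \<in> borel_measurable borel"
    and g: "\<And>s. 0 < s \<Longrightarrow> s < 1 \<Longrightarrow> \<bar>g s\<bar> \<le> C * (1 - s)\<^sup>2"
  shows "set_integrable lborel {0<..<1} (\<lambda>s. w a c s * g s)"
proof (rule set_integrable_bound)
  have "set_integrable lborel {0..1} (\<lambda>t::real. t powr (1 - 1) * (1 - t) powr ((3 - (a + c)) - 1))"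
    using assms by (intro integrable_Beta) auto
  then have "set_integrable lborel {0<..<1} (\<lambda>t::real. t powr (1 - 1) * (1 - t) powr ((3 - (a + c)) - 1))"
    by (rule set_integrable_subset) auto
  then show "set_integrable lborel {0<..<1} (\<lambda>t::real. C * (t powr (1 - 1) * (1 - t) powr ((3 - (a + c)) - 1)))"
    by simp
  show "set_borel_measurable lborel {0<..<1} (\<lambda>s. w a c s * g s)"
    unfolding set_borel_measurable_def by measurable
  have "norm (w a c s * g s) \<le> norm (C * (s powr (1 - 1) * (1 - s) powr ((3 - (a + c)) - 1)))"
    if s: "0 < s" "s < 1" for s
  proof -
    have "0 \<le> C * (1 - s)\<^sup>2" using g[OF s] by linarith
    then have C: "0 \<le> C" using s by (simp add: zero_le_mult_iff)
    have "\<bar>w a c s * g s\<bar> \<le> (1 - s) powr (- (a + c)) * (C * (1 - s)\<^sup>2)"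
      unfolding abs_mult using assms s by (intro mult_mono abs_w_le) auto
    also have "(1 - s)\<^sup>2 = (1 - s) powr 2" using s by simp
    also have "(1 - s) powr (- (a + c)) * (C * (1 - s) powr 2) = C * (1 - s) powr ((3 - (a + c)) - 1)"
      by (simp add: powr_add[symmetric] algebra_simps)
    finally show ?thesis using s C by simp
  qed
  then show "AE s in lborel. s \<in> {0<..<1} \<longrightarrow>
      norm (w a c s * g s) \<le> norm (C * (s powr (1 - 1) * (1 - s) powr ((3 - (a + c)) - 1)))"
    by auto
qed

section \<open>Moments of the weights by contour integration\<close>

lemma exp_eq_1_strip:
  assumes "\<bar>Im z\<bar> < 2 * pi" "exp z = 1"
  shows "z = 0"
proof -
  obtain n :: int where n: "Re z = 0" "Im z = of_int (2 * n) * pi"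
    using assms(2) by (auto simp: exp_eq_1)
  have "\<bar>of_int n\<bar> * (2 * pi) < 1 * (2 * pi)" using assms(1) n by (simp add: abs_mult)
  then have "\<bar>of_int n\<bar> < (1::real)" by (simp add: mult_less_cancel_right)
  then have "n = 0" by linarith
  then show ?thesis using n by (simp add: complex_eq_iff)
qed

text \<open>The integrand \<open>(1 + y) powr (a + c + a / y) / y ^ (j + 2)\<close> with respect to \<open>dy\<close>, where \<open>y = exp z - 1\<close>.
On the cut \<open>y = -1 / (1 - s)\<close>, so \<open>dy / y ^ (j + 2)\<close> becomes \<open>(1 - s) ^ j ds\<close> up to sign.\<close>

definition strip_integrand :: "real \<Rightarrow> real \<Rightarrow> nat \<Rightarrow> complex \<Rightarrow> complex" where
  "strip_integrand a c j z = exp z * \<Phi> a c z / (exp z - 1) ^ Suc (Suc j)"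

lemma strip_integrand_holomorphic: "strip_integrand a c j holomorphic_on {z. \<bar>Im z\<bar> < 2 * pi} - {0}"
  unfolding strip_integrand_def \<Phi>_def using exp_eq_1_strip
  by (auto intro!: holomorphic_intros)

text \<open>On the line \<open>Im z = pi\<close> one has \<open>exp z = - exp x\<close>, and \<open>s = exp x / (1 + exp x)\<close> satisfies
\<open>exp x = s / (1 - s)\<close> and \<open>ds / dx = s * (1 - s)\<close>. The imaginary part of the power produces the sine
in the weight.\<close>

lemma strip_integrand_upper_line:
  fixes x a c :: real and j :: nat
  defines "s \<equiv> exp x / (1 + exp x)"
  shows "Im (strip_integrand a c j (of_real x + of_real pi * \<i>))
     = (-1) ^ Suc j * pi * (s * (1 - s)) * (w a c s * (1 - s) ^ j)"
proof -
  define z where "z = of_real x + of_real pi * \<i>"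
  have ex: "exp z = - of_real (exp x)"
    by (simp add: z_def exp_add exp_of_real mult.commute)
  define k where "k = 1 + exp x"
  have pos: "1 + exp x > 0" by (simp add: add_pos_pos)
  have u: "1 - s = 1 / (1 + exp x)" using pos by (simp add: s_def field_simps)
  have ez: "exp z - 1 = - of_real (1 + exp x)" unfolding ex by simp
  have "of_real (a + c) * z + of_real a * (z / (exp z - 1)) = z * of_real (a + c - a / (1 + exp x))"
    unfolding ez k_def[symmetric] by (simp add: algebra_simps)
  also have "a + c - a / (1 + exp x) = a * (1 - 1 / (1 + exp x)) + c"
    by (simp add: algebra_simps)
  also have "1 - 1 / (1 + exp x) = s" using u by simp
  also have "z * of_real (a * s + c) = of_real (x * (a * s + c)) + \<i> * of_real (pi * (a * s + c))"
    by (simp add: z_def algebra_simps)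
  finally have \<Phi>: "\<Phi> a c z = of_real (exp (x * (a * s + c))) * cis (pi * (a * s + c))"
    unfolding \<Phi>_def by (simp only: exp_add cis_conv_exp exp_of_real)
  have "exp (x * (a * s + c)) = (s / (1 - s)) powr (a * s + c)"
  proof -
    have "s / (1 - s) = exp x" unfolding u using pos by (simp add: s_def)
    then show ?thesis by (simp add: powr_def mult.commute)
  qed
  note R = this
  have "exp z / (exp z - 1) ^ Suc (Suc j) = of_real ((-1) ^ Suc j * exp x * (1 - s) ^ Suc (Suc j))"
    unfolding ez unfolding u ex k_def[symmetric] by (cases "even j") (simp_all add: power_divide)
  moreover have "strip_integrand a c j z = exp z / (exp z - 1) ^ Suc (Suc j) * \<Phi> a c z"
    unfolding strip_integrand_def by (simp only: times_divide_eq_left)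
  ultimately have "strip_integrand a c j z = of_real ((-1) ^ Suc j * exp x * (1 - s) ^ Suc (Suc j)) * \<Phi> a c z"
    by (simp only:)
  then have "Im (strip_integrand a c j z) = (-1) ^ Suc j * (exp x * (1 - s) ^ Suc (Suc j)) * ((s / (1 - s)) powr (a * s + c) * sin (pi * (a * s + c)))"
    unfolding \<Phi> R by simp
  also have "exp x * (1 - s) ^ Suc (Suc j) = s * (1 - s) * (1 - s) ^ j"
  proof -
    have "exp x * (1 - s) = s" unfolding u by (simp add: s_def)
    then show ?thesis by simp
  qed
  finally show ?thesis
    unfolding z_def w_def by (simp add: mult_ac)
qed

lemma strip_integrand_cnj: "strip_integrand a c j (cnj z) = cnj (strip_integrand a c j z)"
  by (simp add: strip_integrand_def \<Phi>_def exp_cnj)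

lemma exp_minus_one_ge:
  fixes T :: real
  assumes "pi \<le> T"
  shows "exp T / 2 \<le> exp T - 1" "T + pi \<le> 2 * (exp T - 1)"
proof -
  have T: "T \<le> exp T - 1" using exp_ge_add_one_self[of T] by linarith
  show "exp T / 2 \<le> exp T - 1" using T assms pi_gt3 by linarith
  have "T + pi \<le> 2 * T" using assms by simp
  also have "\<dots> \<le> 2 * (exp T - 1)" using T by (intro mult_left_mono) auto
  finally show "T + pi \<le> 2 * (exp T - 1)" .
qed

lemma norm_strip_integrand_le_right:
  assumes "0 < a" "Re z = T" "pi \<le> T" "\<bar>Im z\<bar> \<le> pi"
  shows "norm (strip_integrand a c j z) \<le> 2 ^ Suc (Suc j) * exp (2 * a) * exp (- ((real j + 1 - (a + c)) * T))"
proof -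
  have n: "norm (exp z) = exp T" using assms by (simp add: norm_exp_eq_Re)
  then have d: "exp T - 1 \<le> norm (exp z - 1)"
    using norm_triangle_ineq2[of "exp z" 1] by simp
  have d2: "exp T / 2 \<le> norm (exp z - 1)"
    using exp_minus_one_ge(1)[OF assms(3)] d by linarith
  moreover have "0 < exp T / 2" by simp
  ultimately have pos: "0 < norm (exp z - 1)" by linarith
  have "norm z \<le> T + pi" using cmod_le[of z] assms pi_gt3 by simp
  also have "\<dots> \<le> 2 * (exp T - 1)" by (rule exp_minus_one_ge(2)[OF assms(3)])
  also have "\<dots> \<le> 2 * norm (exp z - 1)" using d by (intro mult_left_mono) auto
  finally have "norm (z / (exp z - 1)) \<le> 2"
    unfolding norm_divide using pos by (simp add: pos_divide_le_eq)
  then have "Re (z / (exp z - 1)) \<le> 2"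
    using complex_Re_le_cmod order_trans by blast
  then have "a * Re (z / (exp z - 1)) \<le> a * 2" using assms by (intro mult_left_mono) auto
  then have \<Phi>: "norm (\<Phi> a c z) \<le> exp ((a + c) * T + 2 * a)"
    using assms unfolding \<Phi>_def norm_exp_eq_Re by (simp del: times_divide_eq_right)
  have "norm (strip_integrand a c j z) \<le> exp T * exp ((a + c) * T + 2 * a) / (exp T / 2) ^ Suc (Suc j)"
    unfolding strip_integrand_def norm_divide norm_mult norm_power n using d2 \<Phi>
    by (intro frac_le mult_left_mono mult_nonneg_nonneg power_mono zero_less_power) auto
  also have "(exp T / 2) ^ Suc (Suc j) = exp (real (Suc (Suc j)) * T) / 2 ^ Suc (Suc j)"
    by (simp only: power_divide exp_of_nat_mult)
  also have "exp T * exp ((a + c) * T + 2 * a)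
      = exp (2 * a) * exp (- ((real j + 1 - (a + c)) * T)) * exp (real (Suc (Suc j)) * T)"
    unfolding exp_add[symmetric] by (simp add: algebra_simps)
  finally show ?thesis by (simp add: mult_ac)
qed

text \<open>Here \<open>exp z\<close> is small, so \<open>z / (exp z - 1)\<close> is close to \<open>- z\<close>. Writing it as
\<open>- z + z * exp z / (exp z - 1)\<close> shows that the exponent is \<open>c * z\<close> up to a bounded term.\<close>

lemma norm_strip_integrand_le_left:
  assumes "0 < a" "0 \<le> c" "Re z = - T" "pi \<le> T" "\<bar>Im z\<bar> \<le> pi"
  shows "norm (strip_integrand a c j z) \<le> 2 ^ Suc (Suc j) * exp (2 * a) * exp (- T)"
proof -
  have T: "0 < T" using assms(4) pi_gt_zero by linarith
  have n: "norm (exp z) = exp (- T)" using assms by (simp add: norm_exp_eq_Re)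
  then have d: "1 - exp (- T) \<le> norm (exp z - 1)"
    using norm_triangle_ineq2[of 1 "exp z"] by (simp add: norm_minus_commute)
  have e: "1 - exp (- T) = exp (- T) * (exp T - 1)" by (simp add: right_diff_distrib exp_minus)
  have "exp (- T) * (exp T / 2) \<le> exp (- T) * (exp T - 1)"
    using exp_minus_one_ge(1)[OF assms(4)] by (intro mult_left_mono) auto
  then have d2: "1 / 2 \<le> norm (exp z - 1)" using d e by (simp add: exp_minus)
  then have ne: "exp z - 1 \<noteq> 0" by auto
  have "norm z \<le> T + pi" using cmod_le[of z] assms T by simp
  then have "norm (z * exp z) \<le> (T + pi) * exp (- T)"
    unfolding norm_mult n by (intro mult_right_mono) auto
  also have "\<dots> \<le> 2 * (exp T - 1) * exp (- T)"
    using exp_minus_one_ge(2)[OF assms(4)] by (intro mult_right_mono) auto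
  also have "\<dots> = 2 * (1 - exp (- T))" unfolding e by simp
  also have "\<dots> \<le> 2 * norm (exp z - 1)" using d by (intro mult_left_mono) auto
  finally have "norm (z * exp z / (exp z - 1)) \<le> 2"
    unfolding norm_divide using ne by (simp add: pos_divide_le_eq)
  then have "Re (z * exp z / (exp z - 1)) \<le> 2"
    using complex_Re_le_cmod order_trans by blast
  then have 1: "a * Re (z * exp z / (exp z - 1)) \<le> a * 2" using assms by (intro mult_left_mono) auto
  have 2: "0 \<le> c * T" using assms T by simp
  have "of_real (a + c) * z + of_real a * (z / (exp z - 1))
      = of_real c * z + of_real a * (z * exp z / (exp z - 1))"
    using ne by (simp add: field_simps)
  then have \<Phi>: "norm (\<Phi> a c z) = exp (c * (- T) + a * Re (z * exp z / (exp z - 1)))"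
    using assms unfolding \<Phi>_def norm_exp_eq_Re
    by (simp del: times_divide_eq_right)
  have "norm (\<Phi> a c z) \<le> exp (2 * a)"
    unfolding \<Phi> using 1 2 by simp
  then have "norm (strip_integrand a c j z) \<le> exp (- T) * exp (2 * a) / (1 / 2) ^ Suc (Suc j)"
    unfolding strip_integrand_def norm_divide norm_mult norm_power n using d2
    by (intro frac_le mult_left_mono mult_nonneg_nonneg power_mono zero_less_power) auto
  then show ?thesis by (simp add: power_divide mult_ac)
qed

lemma contour_integral_linepath_horizontal:
  fixes A B h :: real
  assumes "A < B"
  shows "contour_integral (linepath (Complex A h) (Complex B h)) f
    = integral {A..B} (\<lambda>x. f (of_real x + of_real h * \<i>))"
proof -
  have "contour_integral (linepath (Complex A h) (Complex B h)) f
      = contour_integral (linepath (of_real A) (of_real B)) (\<lambda>z. f (z + of_real h * \<i>))"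
    unfolding contour_integral_integral
    by (simp add: linepath_def Complex_eq scaleR_conv_of_real algebra_simps)
  also have "\<dots> = integral {A..B} (\<lambda>x. f (of_real x + of_real h * \<i>))"
    by (subst contour_integral_linepath_Reals_eq) (use assms in auto)
  finally show ?thesis .
qed

lemma tendsto_exp_neg_mult:
  fixes \<kappa> :: real
  assumes "0 < \<kappa>"
  shows "(\<lambda>n. C * exp (- (\<kappa> * real n))) \<longlonglongrightarrow> 0"
proof -
  have "filterlim (\<lambda>n. \<kappa> * real n) at_top sequentially"
    by (rule filterlim_tendsto_pos_mult_at_top[OF tendsto_const assms filterlim_real_sequentially])
  then have "(\<lambda>n. exp (- (\<kappa> * real n))) \<longlonglongrightarrow> 0"
    by (intro filterlim_compose[OF exp_at_bot]) (simp add: filterlim_uminus_at_bot)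
  then show ?thesis by (rule tendsto_mult_right_zero)
qed

text \<open>The residue theorem on the rectangle \<open>[-T, T] \<times> [-pi, pi]\<close>. The integrand takes conjugate values at
conjugate points, so the two horizontal edges together leave only the imaginary part on the upper one.\<close>

lemma strip_integrand_contour_sum:
  fixes a c T :: real
  assumes "0 < T"
  defines "lo \<equiv> - pi" and "hi \<equiv> pi"
  shows "integral {-T..T} (\<lambda>x. Im (strip_integrand a c j (of_real x + of_real pi * \<i>)))
     = - pi * Re (residue (strip_integrand a c j) 0)
       + (Im (contour_integral (linepath (Complex T lo) (Complex T hi)) (strip_integrand a c j))
        + Im (contour_integral (linepath (Complex (- T) hi) (Complex (- T) lo)) (strip_integrand a c j))) / 2"
proof -
  define g where "g x = strip_integrand a c j (of_real x + of_real pi * \<i>)" for x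
  let ?R = "rectpath (Complex (- T) lo) (Complex T hi)"
  define S where "S = {z. \<bar>Im z\<bar> < 2 * pi}"
  have pi0: "lo < 0" "0 < hi" "lo < hi" "\<bar>lo\<bar> < 2 * pi" "\<bar>hi\<bar> < 2 * pi"
    using pi_gt_zero by (auto simp: lo_def hi_def)
  have "S = {z. Im z < 2 * pi} \<inter> {z. Im z > - 2 * pi}" by (auto simp: S_def)
  then have S: "open S" "connected S"
    by (auto intro!: open_Int open_halfspace_Im_lt open_halfspace_Im_gt convex_connected convex_Int
        convex_halfspace_Im_lt convex_halfspace_Im_gt)
  have holo: "strip_integrand a c j holomorphic_on S - {0}" unfolding S_def by (rule strip_integrand_holomorphic)
  have strip: "z \<in> S" if "lo \<le> Im z" "Im z \<le> hi" for z
    unfolding S_def mem_Collect_eq using that pi_gt_zero lo_def hi_def by linarith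
  have cbox: "cbox (Complex (- T) lo) (Complex T hi) \<subseteq> S"
    by (auto simp: in_cbox_complex_iff intro!: strip)
  have img: "path_image ?R = cbox (Complex (- T) lo) (Complex T hi) - box (Complex (- T) lo) (Complex T hi)"
    using assms pi0 by (intro path_image_rectpath_cbox_minus_box) auto
  have zero: "0 \<in> box (Complex (- T) lo) (Complex T hi)"
    using assms pi0 by (simp add: in_box_complex_iff)
  have "contour_integral ?R (strip_integrand a c j) = 2 * pi * \<i> * (\<Sum>p\<in>{0}. winding_number ?R p * residue (strip_integrand a c j) p)"
  proof (rule Residue_theorem[OF S _ holo])
    show "path_image ?R \<subseteq> S - {0}" unfolding img using cbox zero by auto
    show "\<forall>z. z \<notin> S \<longrightarrow> winding_number ?R z = 0"
      using cbox assms pi0 by (auto intro!: winding_number_rectpath_outside)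
  qed auto
  then have R: "contour_integral ?R (strip_integrand a c j) = 2 * pi * \<i> * residue (strip_integrand a c j) 0"
    using winding_number_rectpath[OF zero] by simp
  have seg: "closed_segment (Complex (-T) lo) (Complex T lo) \<subseteq> S - {0}"
    "closed_segment (Complex T lo) (Complex T hi) \<subseteq> S - {0}"
    "closed_segment (Complex T hi) (Complex (-T) hi) \<subseteq> S - {0}"
    "closed_segment (Complex (-T) hi) (Complex (-T) lo) \<subseteq> S - {0}"
    using assms(1) pi0(1-3)
    by (auto simp: closed_segment_same_Re closed_segment_same_Im closed_segment_eq_real_ivl simp del: Im_complex_of_real intro!: strip split: if_splits)
  have cont: "continuous_on (closed_segment u v) (strip_integrand a c j)" if "closed_segment u v \<subseteq> S - {0}" for u v
    using holomorphic_on_imp_continuous_on[OF holo] that continuous_on_subset by blast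
  have intble: "strip_integrand a c j contour_integrable_on linepath u v" if "closed_segment u v \<subseteq> S - {0}" for u v
    using cont[OF that] by (rule contour_integrable_continuous_linepath)
  let ?V = "contour_integral (linepath (Complex T lo) (Complex T hi)) (strip_integrand a c j)
     + contour_integral (linepath (Complex (-T) hi) (Complex (-T) lo)) (strip_integrand a c j)"
  have "contour_integral ?R (strip_integrand a c j) =
       contour_integral (linepath (Complex (-T) lo) (Complex T lo)) (strip_integrand a c j)
     + contour_integral (linepath (Complex T hi) (Complex (-T) hi)) (strip_integrand a c j) + ?V"
    unfolding rectpath_def Let_def by (simp add: intble seg contour_integrable_joinI)
  also have "contour_integral (linepath (Complex T hi) (Complex (-T) hi)) (strip_integrand a c j)
      = - contour_integral (linepath (Complex (-T) hi) (Complex T hi)) (strip_integrand a c j)"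
    using cont[OF seg(3)] by (rule contour_integral_reverse_linepath)
  also have "contour_integral (linepath (Complex (-T) hi) (Complex T hi)) (strip_integrand a c j) = integral {-T..T} g"
    unfolding g_def hi_def using assms by (intro contour_integral_linepath_horizontal) auto
  also have "contour_integral (linepath (Complex (-T) lo) (Complex T lo)) (strip_integrand a c j) = integral {-T..T} (\<lambda>x. cnj (g x))"
  proof -
    have "cnj (g x) = strip_integrand a c j (of_real x + of_real lo * \<i>)" for x
      unfolding g_def strip_integrand_cnj[symmetric] by (simp add: lo_def)
    then show ?thesis
      using assms contour_integral_linepath_horizontal[of "-T" T lo "strip_integrand a c j"] by simp
  qed
  also have "integral {-T..T} (\<lambda>x. cnj (g x)) = cnj (integral {-T..T} g)"
    by (rule integral_cnj[symmetric])
  finally have "2 * pi * \<i> * residue (strip_integrand a c j) 0 = cnj (integral {-T..T} g) + - integral {-T..T} g + ?V"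
    unfolding R .
  then have "Im (2 * pi * \<i> * residue (strip_integrand a c j) 0) = Im (cnj (integral {-T..T} g) + - integral {-T..T} g + ?V)"
    by (rule arg_cong)
  then have "2 * pi * Re (residue (strip_integrand a c j) 0) = - 2 * Im (integral {-T..T} g) + Im ?V"
    by simp
  moreover have "continuous_on {-T..T} g"
    unfolding g_def
  proof (rule continuous_on_compose2[OF holomorphic_on_imp_continuous_on[OF holo]])
    show "continuous_on {-T..T} (\<lambda>x. of_real x + of_real pi * \<i>)" by (intro continuous_intros)
    show "(\<lambda>x. of_real x + of_real pi * \<i>) ` {-T..T} \<subseteq> S - {0}"
      using pi_gt_zero by (auto simp: S_def complex_eq_iff)
  qed
  then have "g integrable_on {-T..T}" by (rule integrable_continuous_real)
  then have "Im (integral {-T..T} g) = integral {-T..T} (\<lambda>x. Im (g x))"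
    by (metis Im_complex_of_real has_integral_Im integrable_integral integral_unique)
  ultimately show ?thesis unfolding g_def by (simp add: field_simps)
qed

text \<open>Letting \<open>T\<close> tend to infinity, the vertical edges disappear: on the right because \<open>a + c < j + 1\<close>, on
the left because of the factor \<open>exp z\<close>. The substitution \<open>s = exp x / (1 + exp x)\<close> carries the upper
edge to \<open>(0, 1)\<close>.\<close>

lemma moment_eq_residue:
  assumes "0 < a" "0 \<le> c" "a + c < 3" "2 \<le> j"
  shows "(LBINT s:{0<..<1}. w a c s * (1 - s) ^ j) = (-1) ^ j * Re (residue (strip_integrand a c j) 0)"
proof -
  define f where "f s = w a c s * (1 - s) ^ j" for s
  define \<sigma> where "\<sigma> x = exp x / (1 + exp x)" for x :: real
  define V where "V n = (Im (contour_integral (linepath (Complex (real n) (- pi)) (Complex (real n) pi)) (strip_integrand a c j))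
        + Im (contour_integral (linepath (Complex (- real n) pi) (Complex (- real n) (- pi))) (strip_integrand a c j))) / 2" for n
  have e1: "1 + exp x > 0" for x :: real by (simp add: add_pos_pos)
  then have \<sigma>01: "0 < \<sigma> x" "\<sigma> x < 1" for x by (auto simp: \<sigma>_def)
  have \<sigma>_eq: "\<sigma> x = 1 - 1 / (1 + exp x)" for x using e1[of x] by (simp add: \<sigma>_def field_simps)
  have \<sigma>_mono: "\<sigma> x < \<sigma> y" if "x < y" for x y
    using that e1[of x] e1[of y] unfolding \<sigma>_eq by (intro diff_strict_left_mono divide_strict_left_mono) auto
  have \<sigma>_deriv: "(\<sigma> has_real_derivative \<sigma> x * (1 - \<sigma> x)) (at x within A)" for x A
    unfolding \<sigma>_def using e1[of x] by (auto intro!: derivative_eq_intros simp: divide_simps power2_eq_square algebra_simps)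
  have int_f: "set_integrable lborel {0<..<1} f"
    unfolding f_def
  proof (rule set_integrable_w_mult[where C = 1])
    fix s :: real assume "0 < s" "s < 1"
    then have "(1 - s) ^ j \<le> (1 - s) ^ 2" using assms by (intro power_decreasing) auto
    then show "\<bar>(1 - s) ^ j\<bar> \<le> 1 * (1 - s)\<^sup>2" using \<open>s < 1\<close> by simp
  qed (use assms in auto)
  have cont_f: "continuous_on {\<sigma> x..\<sigma> y} f" for x y
  proof -
    have s: "s \<noteq> 0" "1 - s \<noteq> 0" if "s \<in> {\<sigma> x..\<sigma> y}" for s
      using that \<sigma>01[of x] \<sigma>01[of y] by auto
    then show ?thesis unfolding f_def w_def
      by (intro continuous_intros ballI) (use s in \<open>simp_all add: divide_eq_0_iff\<close>)
  qed
  have sub: "integral {- real n..real n} (\<lambda>x. Im (strip_integrand a c j (of_real x + of_real pi * \<i>)))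
      = (-1) ^ Suc j * pi * integral {\<sigma> (- real n)..\<sigma> (real n)} f" if n: "0 < n" for n
  proof -
    have mono: "\<sigma> x \<le> \<sigma> y" if "x \<le> y" for x y using \<sigma>_mono[of x y] that by (cases "x = y") auto
    have "((\<lambda>x. (\<sigma> x * (1 - \<sigma> x)) *\<^sub>R f (\<sigma> x)) has_integral (integral {\<sigma> (- real n)..\<sigma> (real n)} f)) {- real n..real n}"
      by (rule has_integral_substitution[OF _ _ _ cont_f \<sigma>_deriv]) (auto intro!: mono)
    then have "((\<lambda>x. (-1) ^ Suc j * pi * ((\<sigma> x * (1 - \<sigma> x)) *\<^sub>R f (\<sigma> x))) has_integral
        ((-1) ^ Suc j * pi * integral {\<sigma> (- real n)..\<sigma> (real n)} f)) {- real n..real n}"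
      by (rule has_integral_mult_right)
    moreover have "(-1) ^ Suc j * pi * ((\<sigma> x * (1 - \<sigma> x)) *\<^sub>R f (\<sigma> x)) = Im (strip_integrand a c j (of_real x + of_real pi * \<i>))" for x
      unfolding strip_integrand_upper_line f_def \<sigma>_def by simp
    ultimately show ?thesis by (simp only: integral_unique)
  qed
  have eq: "(-1) ^ Suc j * pi * integral {\<sigma> (- real n)..\<sigma> (real n)} f = - pi * Re (residue (strip_integrand a c j) 0) + V n" if "0 < n" for n
    using strip_integrand_contour_sum[of "real n" a c j] that sub[OF that] by (simp add: V_def)
  have V0: "V \<longlonglongrightarrow> 0"
  proof (rule Lim_null_comparison)
    define C where "C = 2 ^ Suc (Suc j) * exp (2 * a)"
    have C: "C \<ge> 0" by (simp add: C_def)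
    show "\<forall>\<^sub>F n in sequentially. norm (V n) \<le> C * 2 * pi * exp (- ((real j + 1 - (a + c)) * real n)) + C * 2 * pi * exp (- (1 * real n))"
    proof (rule eventually_sequentiallyI[of 4])
      fix n :: nat assume "4 \<le> n"
      then have n: "pi \<le> real n" using pi_less_4 by linarith
      have n0: "real n \<noteq> 0" using \<open>4 \<le> n\<close> by simp
      have ne: "strip_integrand a c j contour_integrable_on linepath u v"
        if "\<And>z. z \<in> closed_segment u v \<Longrightarrow> \<bar>Im z\<bar> \<le> pi \<and> Re z \<noteq> 0" for u v
      proof (intro contour_integrable_continuous_linepath
          continuous_on_subset[OF holomorphic_on_imp_continuous_on[OF strip_integrand_holomorphic]] subsetI)
        fix z assume "z \<in> closed_segment u v"
        from that[OF this] have "\<bar>Im z\<bar> < 2 * pi" "z \<noteq> 0"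
          using pi_gt_zero by (linarith, auto)
        then show "z \<in> {z. \<bar>Im z\<bar> < 2 * pi} - {0}" by simp
      qed
      have sr: "Re z = real n \<and> \<bar>Im z\<bar> \<le> pi" if "z \<in> closed_segment (Complex (real n) (- pi)) (Complex (real n) pi)" for z
        using that by (auto simp: closed_segment_same_Re closed_segment_eq_real_ivl split: if_splits)
      have sl: "Re z = - real n \<and> \<bar>Im z\<bar> \<le> pi" if "z \<in> closed_segment (Complex (- real n) pi) (Complex (- real n) (- pi))" for z
        using that by (auto simp: closed_segment_same_Re closed_segment_eq_real_ivl split: if_splits)
      have r: "norm (contour_integral (linepath (Complex (real n) (- pi)) (Complex (real n) pi)) (strip_integrand a c j))
          \<le> C * exp (- ((real j + 1 - (a + c)) * real n)) * norm (Complex (real n) pi - Complex (real n) (- pi))"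
      proof (rule contour_integral_bound_linepath)
        show "strip_integrand a c j contour_integrable_on linepath (Complex (real n) (- pi)) (Complex (real n) pi)"
          by (rule ne) (use sr n0 in force)
        show "norm (strip_integrand a c j z) \<le> C * exp (- ((real j + 1 - (a + c)) * real n))"
          if "z \<in> closed_segment (Complex (real n) (- pi)) (Complex (real n) pi)" for z
          unfolding C_def using norm_strip_integrand_le_right[of a z "real n"] sr[OF that] assms n by auto
      qed (use C in auto)
      have l: "norm (contour_integral (linepath (Complex (- real n) pi) (Complex (- real n) (- pi))) (strip_integrand a c j))
          \<le> C * exp (- real n) * norm (Complex (- real n) (- pi) - Complex (- real n) pi)"
      proof (rule contour_integral_bound_linepath)
        show "strip_integrand a c j contour_integrable_on linepath (Complex (- real n) pi) (Complex (- real n) (- pi))"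
          by (rule ne) (use sl n0 in force)
        show "norm (strip_integrand a c j z) \<le> C * exp (- real n)"
          if "z \<in> closed_segment (Complex (- real n) pi) (Complex (- real n) (- pi))" for z
          unfolding C_def using norm_strip_integrand_le_left[of a c z "real n"] sl[OF that] assms n by auto
      qed (use C in auto)
      have len: "norm (Complex (real n) pi - Complex (real n) (- pi)) = 2 * pi"
        "norm (Complex (- real n) (- pi) - Complex (- real n) pi) = 2 * pi"
        by (auto simp: cmod_def real_sqrt_mult)
      have half: "\<bar>(Im x + Im y) / 2\<bar> \<le> norm x + norm y" for x y
      proof -
        have "\<bar>(Im x + Im y) / 2\<bar> \<le> \<bar>Im x + Im y\<bar>" by simp
        also have "\<dots> \<le> norm x + norm y"
          by (rule order_trans[OF abs_triangle_ineq add_mono]) (rule abs_Im_le_cmod)+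
        finally show ?thesis .
      qed
      have "norm (V n) \<le> norm (contour_integral (linepath (Complex (real n) (- pi)) (Complex (real n) pi)) (strip_integrand a c j))
         + norm (contour_integral (linepath (Complex (- real n) pi) (Complex (- real n) (- pi))) (strip_integrand a c j))"
        unfolding V_def real_norm_def by (rule half)
      then show "norm (V n) \<le> C * 2 * pi * exp (- ((real j + 1 - (a + c)) * real n)) + C * 2 * pi * exp (- (1 * real n))"
        using r l unfolding len by (simp add: mult_ac)
    qed
    show "(\<lambda>n. C * 2 * pi * exp (- ((real j + 1 - (a + c)) * real n)) + C * 2 * pi * exp (- (1 * real n))) \<longlonglongrightarrow> 0"
      by (rule tendsto_eq_rhs[OF tendsto_add[OF tendsto_exp_neg_mult tendsto_exp_neg_mult]])
        (use assms in auto)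
  qed
  have lim: "(\<lambda>n. LBINT s=\<sigma> (- real (Suc n))..\<sigma> (real (Suc n)). f s) \<longlonglongrightarrow> (LBINT s=ereal 0..ereal 1. f s)"
  proof (rule interval_integral_Icc_approx_integrable)
    have "filterlim (\<lambda>n. exp (real (Suc n))) at_top sequentially"
      by (intro filterlim_compose[OF exp_at_top] filterlim_compose[OF filterlim_real_sequentially] filterlim_Suc)
    then have "(\<lambda>n. 1 - 1 / (1 + exp (real (Suc n)))) \<longlonglongrightarrow> 1 - 0"
      by (intro tendsto_diff tendsto_const tendsto_divide_0[OF tendsto_const] filterlim_at_top_imp_at_infinity
          filterlim_tendsto_add_at_top[OF tendsto_const])
    then have u: "(\<lambda>n. \<sigma> (real (Suc n))) \<longlonglongrightarrow> 1" unfolding \<sigma>_eq by simp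
    have "(\<lambda>n. 1 - \<sigma> (real (Suc n))) \<longlonglongrightarrow> 1 - 1" by (intro tendsto_intros u)
    moreover have "1 - \<sigma> x = \<sigma> (- x)" for x
      unfolding \<sigma>_def exp_minus using e1[of x] by (simp add: divide_simps)
    ultimately have l: "(\<lambda>n. \<sigma> (- real (Suc n))) \<longlonglongrightarrow> 0" by simp
    show "(\<lambda>n. ereal (\<sigma> (- real (Suc n)))) \<longlonglongrightarrow> ereal 0" using l by simp
    show "(\<lambda>n. ereal (\<sigma> (real (Suc n)))) \<longlonglongrightarrow> ereal 1" using u by simp
    show "einterval (ereal 0) (ereal 1) = (\<Union>i. {\<sigma> (- real (Suc i))..\<sigma> (real (Suc i))})"
    proof (intro equalityI subsetI)
      fix s assume "s \<in> einterval (ereal 0) (ereal 1)"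
      then have s: "0 < s" "s < 1" by auto
      have "\<forall>\<^sub>F n in sequentially. \<sigma> (- real (Suc n)) < s \<and> s < \<sigma> (real (Suc n))"
        using order_tendstoD(2)[OF l s(1)] order_tendstoD(1)[OF u s(2)] by (rule eventually_conj)
      then obtain n where "\<sigma> (- real (Suc n)) < s \<and> s < \<sigma> (real (Suc n))"
        unfolding eventually_sequentially by blast
      then show "s \<in> (\<Union>i. {\<sigma> (- real (Suc i))..\<sigma> (real (Suc i))})" by (auto intro!: exI[of _ n])
    next
      fix s assume "s \<in> (\<Union>i. {\<sigma> (- real (Suc i))..\<sigma> (real (Suc i))})"
      then obtain i where "\<sigma> (- real (Suc i)) \<le> s" "s \<le> \<sigma> (real (Suc i))" by auto
      then show "s \<in> einterval (ereal 0) (ereal 1)"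
        using \<sigma>01[of "- real (Suc i)"] \<sigma>01[of "real (Suc i)"] by auto
    qed
    show "incseq (\<lambda>n. \<sigma> (real (Suc n)))"
      by (rule incseq_SucI) (auto intro!: less_imp_le \<sigma>_mono)
    show "decseq (\<lambda>n. \<sigma> (- real (Suc n)))"
      by (rule decseq_SucI) (auto intro!: less_imp_le \<sigma>_mono)
    show "set_integrable lborel (einterval (ereal 0) (ereal 1)) f" using int_f by simp
  qed (auto simp: \<sigma>01 intro!: \<sigma>_mono)
  have "(LBINT s=\<sigma> (- real (Suc n))..\<sigma> (real (Suc n)). f s) = integral {\<sigma> (- real (Suc n))..\<sigma> (real (Suc n))} f" for n
    using \<sigma>_mono[of "- real (Suc n)" "real (Suc n)"] borel_integrable_atLeastAtMost'[OF cont_f]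
    by (intro interval_integral_eq_integral) auto
  then have lim': "(\<lambda>n. integral {\<sigma> (- real (Suc n))..\<sigma> (real (Suc n))} f) \<longlonglongrightarrow> (LBINT s:{0<..<1}. f s)"
    using lim by (simp add: interval_integral_Ioo)
  then have "(\<lambda>n. (-1) ^ Suc j * pi * integral {\<sigma> (- real (Suc n))..\<sigma> (real (Suc n))} f) \<longlonglongrightarrow> (-1) ^ Suc j * pi * (LBINT s:{0<..<1}. f s)"
    by (intro tendsto_intros)
  moreover have "(\<lambda>n. - pi * Re (residue (strip_integrand a c j) 0) + V (Suc n)) \<longlonglongrightarrow> - pi * Re (residue (strip_integrand a c j) 0) + 0"
    by (intro tendsto_intros LIMSEQ_Suc[OF V0])
  ultimately have "(-1) ^ Suc j * pi * (LBINT s:{0<..<1}. f s) = - pi * Re (residue (strip_integrand a c j) 0) + 0"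
    unfolding eq[OF zero_less_Suc] by (rule LIMSEQ_unique)
  then have "pi * ((-1) ^ j * (LBINT s:{0<..<1}. f s)) = pi * Re (residue (strip_integrand a c j) 0)"
    by simp
  then have "(-1) ^ j * (LBINT s:{0<..<1}. f s) = Re (residue (strip_integrand a c j) 0)"
    by simp
  then show ?thesis unfolding f_def by (cases "even j") auto
qed

lemma second_moment:
  assumes "0 < a" "0 \<le> c" "a + c < 3"
  shows "exp (- a) * (LBINT s:{0<..<1}. w a c s * (1 - s)\<^sup>2) = taylor3 a c"
proof -
  obtain E where E: "\<And>n. residue (\<lambda>z. exp z * \<Phi> a c z / (exp z - 1) ^ Suc n) 0 = of_real (exp a) * fps_nth E n"
    "fps_nth E 3 = of_real (taylor3 a c)" by (rule residue_\<Phi>) blast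
  have "residue (strip_integrand a c 2) 0 = of_real (exp a * taylor3 a c)"
    using E(1)[of 3] E(2) unfolding strip_integrand_def by (simp add: eval_nat_numeral)
  then show ?thesis using moment_eq_residue[OF assms, of 2] by (simp add: exp_minus)
qed

lemma third_moment:
  assumes "0 < a" "0 \<le> c" "a + c < 3"
  shows "exp (- a) * (LBINT s:{0<..<1}. w a c s * (1 - s) ^ 3) = - taylor4 a c"
proof -
  obtain E where E: "\<And>n. residue (\<lambda>z. exp z * \<Phi> a c z / (exp z - 1) ^ Suc n) 0 = of_real (exp a) * fps_nth E n"
    "fps_nth E 4 = of_real (taylor4 a c)" by (rule residue_\<Phi>) blast
  have "residue (strip_integrand a c 3) 0 = of_real (exp a * taylor4 a c)"
    using E(1)[of 4] E(2) unfolding strip_integrand_def by (simp add: eval_nat_numeral)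
  then show ?thesis using moment_eq_residue[OF assms, of 3] by (simp add: exp_minus)
qed

section \<open>Tails of the exponential series\<close>

lemma exp_tail_sums:
  fixes x :: real
  shows "(\<lambda>n. x ^ (n + 3) / fact (n + 3)) sums (exp x - 1 - x - x\<^sup>2 / 2)"
proof -
  have "(\<lambda>n. x ^ n / fact n) sums exp x"
    using exp_converges[of x] by (simp add: divide_inverse mult.commute)
  then have "(\<lambda>n. x ^ (n + 3) / fact (n + 3)) sums (exp x - (\<Sum>n<3. x ^ n / fact n))"
    by (rule sums_split_initial_segment)
  moreover have "exp x - (\<Sum>n<3. x ^ n / fact n) = exp x - 1 - x - x\<^sup>2 / 2"
    by (simp add: eval_nat_numeral)
  ultimately show ?thesis by simp
qed

text \<open>The quotient \<open>(exp x - 1 - x - x\<^sup>2 / 2) / x ^ 3\<close> is a power series with positive coefficients, hence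
increasing for \<open>x \<ge> 0\<close>. Multiplied out, this also covers \<open>u = 0\<close>.\<close>

lemma exp_tail_cube_mono:
  fixes u v t :: real
  assumes "0 \<le> u" "u \<le> v" "0 \<le> t"
  shows "v ^ 3 * (exp (u * t) - 1 - u * t - (u * t)\<^sup>2 / 2) \<le> u ^ 3 * (exp (v * t) - 1 - v * t - (v * t)\<^sup>2 / 2)"
proof (rule sums_le[OF _ sums_mult[OF exp_tail_sums] sums_mult[OF exp_tail_sums]])
  fix n
  have "u ^ n * (u ^ 3 * v ^ 3 * t ^ (n + 3) / fact (n + 3)) \<le> v ^ n * (u ^ 3 * v ^ 3 * t ^ (n + 3) / fact (n + 3))"
    using assms by (intro mult_right_mono power_mono) auto
  then show "v ^ 3 * ((u * t) ^ (n + 3) / fact (n + 3)) \<le> u ^ 3 * ((v * t) ^ (n + 3) / fact (n + 3))"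
    by (simp only: power_mult_distrib power_add) (simp add: mult_ac)
qed

lemma exp_tail_ge:
  fixes x :: real
  assumes "0 \<le> x"
  shows "x ^ 3 / 6 + x ^ 4 / 24 \<le> exp x - 1 - x - x\<^sup>2 / 2"
proof -
  have "(\<Sum>n<2. x ^ (n + 3) / fact (n + 3)) \<le> exp x - 1 - x - x\<^sup>2 / 2"
    unfolding sums_unique[OF exp_tail_sums]
    using assms by (intro sum_le_suminf sums_summable[OF exp_tail_sums]) auto
  then show ?thesis by (simp add: eval_nat_numeral)
qed

lemma exp_tail_le_square:
  fixes t u :: real
  assumes "0 \<le> u" "u \<le> 1" "0 \<le> t"
  shows "\<bar>exp (u * t) - 1 - u * t\<bar> \<le> exp t * u\<^sup>2"
proof -
  have "0 \<le> exp (u * t) - 1 - u * t" using exp_ge_add_one_self[of "u * t"] by linarith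
  moreover have "exp (u * t) - 1 - u * t \<le> exp t * u\<^sup>2"
  proof -
    have ut: "0 \<le> u * t" "u * t \<le> t" using assms by (auto simp: mult_left_le_one_le)
    have "u ^ 3 * (exp (1 * t) - 1 - 1 * t - (1 * t)\<^sup>2 / 2) \<le> u\<^sup>2 * (exp (1 * t) - 1 - 1 * t - (1 * t)\<^sup>2 / 2)"
    proof (intro mult_right_mono power_decreasing)
      have "0 \<le> t ^ 3 / 6 + t ^ 4 / 24" using assms by simp
      then show "0 \<le> exp (1 * t) - 1 - 1 * t - (1 * t)\<^sup>2 / 2" using exp_tail_ge[OF assms(3)] by simp
    qed (use assms in auto)
    then have "exp (u * t) - 1 - u * t - (u * t)\<^sup>2 / 2 \<le> u\<^sup>2 * (exp t - 1 - t - t\<^sup>2 / 2)"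
      using exp_tail_cube_mono[of u 1 t] assms by simp
    then have "exp (u * t) - 1 - u * t \<le> u\<^sup>2 * (exp t - 1 - t)"
      by (simp add: algebra_simps power_mult_distrib)
    also have "\<dots> \<le> u\<^sup>2 * exp t" using assms by (intro mult_left_mono) auto
    finally show ?thesis by (simp add: mult.commute)
  qed
  ultimately show ?thesis by simp
qed

section \<open>The moments of the density gap\<close>

text \<open>The gap of the third Taylor coefficients is \<open>\<delta> * (1 - \<delta>)\<close> times an explicit polynomial in
\<open>\<beta> = \<alpha> / 2 - 1\<close> and \<open>\<delta>\<close>. The constant is its bound at \<open>\<beta> = 1/6\<close>, \<open>\<delta> = 1\<close>.\<close>

lemma taylor3_gap_ge:
  fixes \<alpha> \<delta> :: real
  assumes "2 \<le> \<alpha>" "\<alpha> \<le> 7/3" "0 < \<delta>" "\<delta> < 1"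
  shows "- (11/324) * (\<delta> * (1 - \<delta>)) \<le> taylor3 (\<alpha> * \<delta>) (1 - \<delta>) - \<delta> * taylor3 \<alpha> 0"
proof -
  define \<beta> where "\<beta> = \<alpha> / 2 - 1"
  have \<alpha>: "\<alpha> = 2 * \<beta> + 2" and \<beta>: "0 \<le> \<beta>" "\<beta> \<le> 1/6" using assms by (auto simp: \<beta>_def)
  have "taylor3 (\<alpha> * \<delta>) (1 - \<delta>) - \<delta> * taylor3 \<alpha> 0
      = \<delta> * (1 - \<delta>) * - ((\<beta> + \<beta> ^ 2 + \<beta> ^ 3 * (1 + \<delta>)) / 6)"
    unfolding \<alpha> taylor3_def log_coeff_def Let_def by (simp add: field_simps power2_eq_square power3_eq_cube)
  moreover have "(\<beta> + \<beta> ^ 2 + \<beta> ^ 3 * (1 + \<delta>)) / 6 \<le> (1/6 + (1/6)^2 + (1/6)^3 * (1 + 1)) / 6"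
    using \<beta> assms by (intro divide_right_mono add_mono mult_mono power_mono) auto
  then have "\<delta> * (1 - \<delta>) * - (11/324) \<le> \<delta> * (1 - \<delta>) * - ((\<beta> + \<beta> ^ 2 + \<beta> ^ 3 * (1 + \<delta>)) / 6)"
    using assms by (intro mult_left_mono) (auto simp: power_divide)
  ultimately show ?thesis by (simp add: mult_ac)
qed

text \<open>Again \<open>\<delta> * (1 - \<delta>)\<close> splits off. The constant is \<open>1/72 - \<beta>/18 - \<beta>\<^sup>2/36\<close> at \<open>\<beta> = 1/6\<close>; the remaining
terms are collected in the nonnegative \<open>r\<close>.\<close>

lemma taylor4_gap_ge:
  fixes \<alpha> \<delta> :: real
  assumes "2 \<le> \<alpha>" "\<alpha> \<le> 7/3" "0 < \<delta>" "\<delta> < 1"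
  shows "5/1296 * (\<delta> * (1 - \<delta>)) \<le> - (taylor4 (\<alpha> * \<delta>) (1 - \<delta>) - \<delta> * taylor4 \<alpha> 0)"
proof -
  define \<beta> where "\<beta> = \<alpha> / 2 - 1"
  have \<alpha>: "\<alpha> = 2 * \<beta> + 2" and \<beta>: "0 \<le> \<beta>" "\<beta> \<le> 1/6" using assms by (auto simp: \<beta>_def)
  define r where "r = \<beta> ^ 2 * \<delta> / 12 + \<beta> ^ 4 * (1 + \<delta> + \<delta> ^ 2) / 24"
  have r: "0 \<le> r" using \<beta> assms by (simp add: r_def)
  have "- (taylor4 (\<alpha> * \<delta>) (1 - \<delta>) - \<delta> * taylor4 \<alpha> 0)
      = \<delta> * (1 - \<delta>) * (1/72 - \<beta>/18 - \<beta> ^ 2 / 36 + r)"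
    unfolding \<alpha> taylor4_def log_coeff_def Let_def r_def
    by (simp add: field_simps power2_eq_square power3_eq_cube power4_eq_xxxx)
  moreover have "\<beta> ^ 2 \<le> (1/6) ^ 2" using \<beta> by (intro power_mono) auto
  then have "5/1296 \<le> 1/72 - \<beta>/18 - \<beta> ^ 2 / 36 + r"
    using \<beta> r by (simp add: power_divide)
  then have "\<delta> * (1 - \<delta>) * (5/1296) \<le> \<delta> * (1 - \<delta>) * (1/72 - \<beta>/18 - \<beta> ^ 2 / 36 + r)"
    using assms by (intro mult_left_mono) auto
  ultimately show ?thesis by (simp add: mult_ac)
qed

text \<open>The lower bound for the integral that the two moment estimates leave, divided by
\<open>\<delta> * (1 - \<delta>)\<close> and increased by \<open>8/9\<close>.\<close>

lemma quartic_nonneg: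
  fixes t :: real
  assumes "0 \<le> t"
  shows "0 \<le> 8/9 - 11/324 * (t\<^sup>2 / 2) + 5/1296 * (t ^ 3 / 6 + t ^ 4 / 48)"
proof (cases "t \<le> 7")
  case True
  then have "t\<^sup>2 \<le> 7\<^sup>2" using assms by (intro power_mono) auto
  moreover have "0 \<le> t ^ 3 / 6 + t ^ 4 / 48" using assms by simp
  ultimately show ?thesis by simp
next
  case False
  then have "7 * t\<^sup>2 \<le> t * t\<^sup>2" by (intro mult_right_mono) auto
  then have 1: "7 * t\<^sup>2 \<le> t ^ 3" by (simp add: power3_eq_cube power2_eq_square)
  \<comment> \<open>The cubic term is at least 7 t^2; a tangent parabola at t^2 = 80 disposes of the rest.\<close>
  have "0 \<le> (t\<^sup>2 - 80)\<^sup>2" by simp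
  then have 2: "160 * t\<^sup>2 \<le> t ^ 4 + 6400" by (simp add: power2_eq_square power4_eq_xxxx algebra_simps)
  have "0 \<le> 55296 - 1056 * t\<^sup>2 + 40 * t ^ 3 + 5 * t ^ 4"
    using 1 2 zero_le_power2[of t] by linarith
  then have "0 \<le> (55296 - 1056 * t\<^sup>2 + 40 * t ^ 3 + 5 * t ^ 4) / 62208" by simp
  also have "\<dots> = 8/9 - 11/324 * (t\<^sup>2 / 2) + 5/1296 * (t ^ 3 / 6 + t ^ 4 / 48)"
    by (simp add: field_simps)
  finally show ?thesis .
qed

section \<open>The comparison\<close>

lemma density_gap_integrals:
  assumes "2 \<le> \<alpha>" "\<alpha> \<le> 7/3" "0 < \<delta>" "\<delta> < 1" "g \<in> borel_measurable borel"
    and "\<And>s. 0 < s \<Longrightarrow> s < 1 \<Longrightarrow> \<bar>g s\<bar> \<le> C * (1 - s)\<^sup>2"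
  shows "set_integrable lborel {0<..<1} (\<lambda>s. density_gap \<alpha> \<delta> s * g s)"
    and "(LBINT s:{0<..<1}. density_gap \<alpha> \<delta> s * g s)
      = exp (- (\<alpha> * \<delta>)) * (LBINT s:{0<..<1}. w (\<alpha> * \<delta>) (1 - \<delta>) s * g s)
        - \<delta> * (exp (- \<alpha>) * (LBINT s:{0<..<1}. w \<alpha> 0 s * g s))"
proof -
  have "\<alpha> * \<delta> \<le> 7/3 * \<delta>" using assms by (intro mult_right_mono) auto
  then have "\<alpha> * \<delta> + (1 - \<delta>) < 3" using assms by linarith
  then have 1: "set_integrable lborel {0<..<1} (\<lambda>s. w (\<alpha> * \<delta>) (1 - \<delta>) s * g s)"
    using assms by (intro set_integrable_w_mult[where C = C]) auto
  have 2: "set_integrable lborel {0<..<1} (\<lambda>s. w \<alpha> 0 s * g s)"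
    using assms by (intro set_integrable_w_mult[where C = C]) auto
  have density_gap: "density_gap \<alpha> \<delta> s * g s = exp (- (\<alpha> * \<delta>)) * (w (\<alpha> * \<delta>) (1 - \<delta>) s * g s)
      - \<delta> * (exp (- \<alpha>) * (w \<alpha> 0 s * g s))" for s
    by (simp add: density_gap_def algebra_simps)
  show "set_integrable lborel {0<..<1} (\<lambda>s. density_gap \<alpha> \<delta> s * g s)"
    unfolding density_gap by (intro set_integral_diff set_integrable_mult_right 1 2)
  show "(LBINT s:{0<..<1}. density_gap \<alpha> \<delta> s * g s)
      = exp (- (\<alpha> * \<delta>)) * (LBINT s:{0<..<1}. w (\<alpha> * \<delta>) (1 - \<delta>) s * g s)
        - \<delta> * (exp (- \<alpha>) * (LBINT s:{0<..<1}. w \<alpha> 0 s * g s))"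
    unfolding density_gap by (subst set_integral_diff(2)) (use 1 2 in \<open>auto intro!: set_integrable_mult_right\<close>)
qed

text \<open>The single sign change drives the proof. The factor \<open>C\<close> is chosen so that the cubic
\<open>(t * u)\<^sup>2 / 2 + C * u ^ 3\<close> agrees with \<open>exp (u * t) - 1 - u * t\<close> at \<open>u = 1 - 1 / \<alpha>\<close>. The difference of
the two then changes sign exactly where the density gap does, and the product is nonnegative.\<close>

lemma density_gap_mult_exp_tail_ge:
  fixes \<alpha> \<delta> s t :: real
  assumes "2 \<le> \<alpha>" "\<alpha> \<le> 7/3" "0 < \<delta>" "\<delta> < 1" "0 < s" "s < 1" "0 \<le> t"
  defines "v \<equiv> 1 - 1 / \<alpha>"
  defines "C \<equiv> (exp (v * t) - 1 - v * t - (v * t)\<^sup>2 / 2) / v ^ 3"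
  shows "density_gap \<alpha> \<delta> s * (t\<^sup>2 / 2 * (1 - s)\<^sup>2 + C * (1 - s) ^ 3)
       \<le> density_gap \<alpha> \<delta> s * (exp ((1 - s) * t) - 1 - (1 - s) * t)"
proof -
  define T where "T u = exp (u * t) - 1 - u * t - (u * t)\<^sup>2 / 2" for u
  have v: "v > 0" using assms(1) by (simp add: v_def field_simps)
  have C: "C = T v / v ^ 3" by (simp add: C_def T_def)
  have "0 \<le> density_gap \<alpha> \<delta> s * (T (1 - s) - C * (1 - s) ^ 3)"
  proof (cases "s \<le> 1 / \<alpha>")
    case True
    then have "(1 - s) ^ 3 * T v \<le> v ^ 3 * T (1 - s)"
      unfolding T_def using assms v by (intro exp_tail_cube_mono) (auto simp: v_def)
    then have "0 \<le> T (1 - s) - C * (1 - s) ^ 3" unfolding C using v by (simp add: field_simps)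
    then show ?thesis using density_gap_nonneg[of \<alpha> \<delta> s] True assms by simp
  next
    case False
    then have "v ^ 3 * T (1 - s) \<le> (1 - s) ^ 3 * T v"
      unfolding T_def using assms v by (intro exp_tail_cube_mono) (auto simp: v_def)
    then have "T (1 - s) - C * (1 - s) ^ 3 \<le> 0" unfolding C using v by (simp add: field_simps)
    then show ?thesis using density_gap_nonpos[of \<alpha> \<delta> s] False assms by (simp add: mult_nonpos_nonpos)
  qed
  then show ?thesis unfolding T_def power_mult_distrib by (simp add: algebra_simps)
qed

text \<open>The constant and linear terms of \<open>D\<close> contribute \<open>1 - \<delta>\<close> and a nonnegative multiple of \<open>t\<close>. The integral
is bounded below by the second and third moments of the density gap, which are explicit.\<close>

lemma D_diff_ge:
  fixes \<alpha> \<delta> t :: real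
  assumes "2 \<le> \<alpha>" "\<alpha> \<le> 7/3" "0 < \<delta>" "\<delta> < 1" "0 \<le> t"
  shows "\<delta> * D \<alpha> 0 t + (1 - \<delta>) * (1 - 8/9 * \<delta>) \<le> D (\<alpha> * \<delta>) (1 - \<delta>) t"
proof -
  define v where "v = 1 - 1 / \<alpha>"
  define C where "C = (exp (v * t) - 1 - v * t - (v * t)\<^sup>2 / 2) / v ^ 3"
  define h where "h s = exp ((1 - s) * t) - 1 - (1 - s) * t" for s
  define p where "p s = t\<^sup>2 / 2 * (1 - s)\<^sup>2 + C * (1 - s) ^ 3" for s
  define \<epsilon> where "\<epsilon> = \<delta> * (1 - \<delta>)"
  have \<epsilon>: "0 < \<epsilon>" using assms by (simp add: \<epsilon>_def)
  have "1 / \<alpha> \<le> 1/2" using assms by (simp add: field_simps)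
  then have v: "1/2 \<le> v" by (simp add: v_def)
  have C: "t ^ 3 / 6 + t ^ 4 / 48 \<le> C"
  proof -
    have "(t ^ 3 / 6 + t ^ 4 / 48) * v ^ 3 = (v * t) ^ 3 / 6 + (1/2) * (v ^ 3 * t ^ 4) / 24"
      by (simp add: power_mult_distrib algebra_simps)
    also have "\<dots> \<le> (v * t) ^ 3 / 6 + v * (v ^ 3 * t ^ 4) / 24"
      using v assms by (intro add_left_mono divide_right_mono mult_right_mono) auto
    also have "\<dots> = (v * t) ^ 3 / 6 + (v * t) ^ 4 / 24"
      by (simp add: power_mult_distrib power4_eq_xxxx power3_eq_cube mult_ac)
    also have "\<dots> \<le> exp (v * t) - 1 - v * t - (v * t)\<^sup>2 / 2"
      using v assms by (intro exp_tail_ge) auto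
    finally show ?thesis using v by (simp add: C_def pos_le_divide_eq)
  qed
  have h2: "\<bar>(1 - s)\<^sup>2\<bar> \<le> 1 * (1 - s)\<^sup>2" for s :: real by simp
  have h3: "\<bar>(1 - s) ^ 3\<bar> \<le> 1 * (1 - s)\<^sup>2" if "0 < s" "s < 1" for s :: real
    using that power_decreasing[of 2 3 "1 - s"] by simp
  have h: "\<bar>h s\<bar> \<le> exp t * (1 - s)\<^sup>2" if "0 < s" "s < 1" for s
    unfolding h_def using exp_tail_le_square[of "1 - s" t] that assms by simp
  have hm: "h \<in> borel_measurable borel" unfolding h_def by measurable
  note int = density_gap_integrals[OF assms(1-4)]
  have K2: "set_integrable lborel {0<..<1} (\<lambda>s. density_gap \<alpha> \<delta> s * (1 - s)\<^sup>2)" by (rule int(1)[OF _ h2]) auto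
  have K3: "set_integrable lborel {0<..<1} (\<lambda>s. density_gap \<alpha> \<delta> s * (1 - s) ^ 3)" by (rule int(1)[OF _ h3]) auto
  have Kh: "set_integrable lborel {0<..<1} (\<lambda>s. density_gap \<alpha> \<delta> s * h s)" by (rule int(1)[OF hm h]) auto
  have K_int: "(LBINT s:{0<..<1}. density_gap \<alpha> \<delta> s * h s)
      = exp (- (\<alpha> * \<delta>)) * (LBINT s:{0<..<1}. w (\<alpha> * \<delta>) (1 - \<delta>) s * h s)
        - \<delta> * (exp (- \<alpha>) * (LBINT s:{0<..<1}. w \<alpha> 0 s * h s))"
    by (rule int(2)[OF hm h]) auto
  have ac: "\<alpha> * \<delta> + (1 - \<delta>) < 3"
    using mult_right_mono[OF assms(2), of \<delta>] assms by linarith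
  have m2: "(LBINT s:{0<..<1}. density_gap \<alpha> \<delta> s * (1 - s)\<^sup>2) = taylor3 (\<alpha> * \<delta>) (1 - \<delta>) - \<delta> * taylor3 \<alpha> 0"
    using assms ac second_moment[of "\<alpha> * \<delta>" "1 - \<delta>"] second_moment[of \<alpha> 0]
    by (subst int(2)[OF _ h2]) auto
  have m3: "(LBINT s:{0<..<1}. density_gap \<alpha> \<delta> s * (1 - s) ^ 3) = - (taylor4 (\<alpha> * \<delta>) (1 - \<delta>) - \<delta> * taylor4 \<alpha> 0)"
    using assms ac third_moment[of "\<alpha> * \<delta>" "1 - \<delta>"] third_moment[of \<alpha> 0]
    by (subst int(2)[OF _ h3]) auto
  have Kp: "density_gap \<alpha> \<delta> s * p s = (t\<^sup>2 / 2) * (density_gap \<alpha> \<delta> s * (1 - s)\<^sup>2) + C * (density_gap \<alpha> \<delta> s * (1 - s) ^ 3)" for s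
    by (simp add: p_def algebra_simps)
  have "- (8/9) * \<epsilon> \<le> \<epsilon> * (- (11/324) * (t\<^sup>2 / 2) + 5/1296 * (t ^ 3 / 6 + t ^ 4 / 48))"
    using mult_left_mono[OF quartic_nonneg[OF assms(5)], of \<epsilon>] \<epsilon> by (simp add: algebra_simps)
  also have "\<dots> = (t\<^sup>2 / 2) * (- (11/324) * \<epsilon>) + (t ^ 3 / 6 + t ^ 4 / 48) * (5/1296 * \<epsilon>)"
    by (simp add: algebra_simps)
  also have "\<dots> \<le> (t\<^sup>2 / 2) * (taylor3 (\<alpha> * \<delta>) (1 - \<delta>) - \<delta> * taylor3 \<alpha> 0)
      + C * - (taylor4 (\<alpha> * \<delta>) (1 - \<delta>) - \<delta> * taylor4 \<alpha> 0)"
  proof (rule add_mono[OF mult_left_mono mult_mono])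
    show "- (11/324) * \<epsilon> \<le> taylor3 (\<alpha> * \<delta>) (1 - \<delta>) - \<delta> * taylor3 \<alpha> 0"
      unfolding \<epsilon>_def using assms by (intro taylor3_gap_ge) auto
    show "5/1296 * \<epsilon> \<le> - (taylor4 (\<alpha> * \<delta>) (1 - \<delta>) - \<delta> * taylor4 \<alpha> 0)"
      unfolding \<epsilon>_def using assms by (intro taylor4_gap_ge) auto
    have "0 \<le> t ^ 3 / 6 + t ^ 4 / 48" using assms by simp
    then show "0 \<le> C" using C by linarith
  qed (use C \<epsilon> in auto)
  also have "\<dots> = (LBINT s:{0<..<1}. density_gap \<alpha> \<delta> s * p s)"
    unfolding Kp m2[symmetric] m3[symmetric]
    by (subst set_integral_add(2)) (use K2 K3 in \<open>auto intro!: set_integrable_mult_right\<close>)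
  also have "\<dots> \<le> (LBINT s:{0<..<1}. density_gap \<alpha> \<delta> s * h s)"
  proof (rule set_integral_mono)
    show "set_integrable lborel {0<..<1} (\<lambda>s. density_gap \<alpha> \<delta> s * p s)"
      unfolding Kp using K2 K3 by (intro set_integral_add(1) set_integrable_mult_right)
    show "density_gap \<alpha> \<delta> s * p s \<le> density_gap \<alpha> \<delta> s * h s" if "s \<in> {0<..<1}" for s
      using density_gap_mult_exp_tail_ge[of \<alpha> \<delta> s t] that assms by (simp add: p_def h_def C_def v_def)
  qed (rule Kh)
  finally have int_ge: "- (8/9) * \<epsilon> \<le> (LBINT s:{0<..<1}. density_gap \<alpha> \<delta> s * h s)" .
  have q: "q1 (\<alpha> * \<delta>) (1 - \<delta>) - \<delta> * q1 \<alpha> 0 = 1 - \<delta>"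
    "(q1 (\<alpha> * \<delta>) (1 - \<delta>) - q2 (\<alpha> * \<delta>) (1 - \<delta>)) - \<delta> * (q1 \<alpha> 0 - q2 \<alpha> 0) = \<epsilon> * (1 - \<alpha> / 2)\<^sup>2 / 2"
    by (simp_all add: q1_def q2_def \<epsilon>_def field_simps power2_eq_square)
  have "D (\<alpha> * \<delta>) (1 - \<delta>) t - \<delta> * D \<alpha> 0 t
     = (q1 (\<alpha> * \<delta>) (1 - \<delta>) - \<delta> * q1 \<alpha> 0)
       + ((q1 (\<alpha> * \<delta>) (1 - \<delta>) - q2 (\<alpha> * \<delta>) (1 - \<delta>)) - \<delta> * (q1 \<alpha> 0 - q2 \<alpha> 0)) * t
       + (LBINT s:{0<..<1}. density_gap \<alpha> \<delta> s * h s)"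
    unfolding K_int unfolding D_def h_def by (simp add: algebra_simps)
  also have "\<dots> = (1 - \<delta>) + \<epsilon> * (1 - \<alpha> / 2)\<^sup>2 / 2 * t + (LBINT s:{0<..<1}. density_gap \<alpha> \<delta> s * h s)"
    unfolding q ..
  finally have "D (\<alpha> * \<delta>) (1 - \<delta>) t - \<delta> * D \<alpha> 0 t
      = (1 - \<delta>) + \<epsilon> * (1 - \<alpha> / 2)\<^sup>2 / 2 * t + (LBINT s:{0<..<1}. density_gap \<alpha> \<delta> s * h s)" .
  moreover have "0 \<le> \<epsilon> * (1 - \<alpha> / 2)\<^sup>2 / 2 * t" using \<epsilon> assms by simp
  moreover have "(1 - \<delta>) * (1 - 8/9 * \<delta>) = (1 - \<delta>) + - (8/9) * \<epsilon>" by (simp add: \<epsilon>_def algebra_simps)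
  ultimately show ?thesis using int_ge by linarith
qed

theorem theorem10:
  fixes \<alpha> \<delta> :: real
  assumes "2 \<le> \<alpha>" and "\<alpha> \<le> 7 / 3"
    and "0 < \<delta>" and "\<delta> < 1"
  shows "(\<forall>t\<ge>0. D (\<alpha> * \<delta>) (1 - \<delta>) t \<ge> \<delta> * D \<alpha> 0 t + (1 - \<delta>) * (1 - 8 / 9 * \<delta>))
    \<and> ((\<forall>t\<ge>0. D \<alpha> 0 t \<ge> 0) \<longrightarrow> (\<forall>t\<ge>0. D (\<alpha> * \<delta>) (1 - \<delta>) t > 0))"
proof -
  have ge: "\<delta> * D \<alpha> 0 t + (1 - \<delta>) * (1 - 8 / 9 * \<delta>) \<le> D (\<alpha> * \<delta>) (1 - \<delta>) t" if "0 \<le> t" for t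
    using D_diff_ge assms that by simp
  have pos: "0 < (1 - \<delta>) * (1 - 8 / 9 * \<delta>)" using assms by simp
  have "0 < D (\<alpha> * \<delta>) (1 - \<delta>) t" if "\<forall>t\<ge>0. D \<alpha> 0 t \<ge> 0" "0 \<le> t" for t
  proof -
    have "0 \<le> \<delta> * D \<alpha> 0 t" using that assms by simp
    then show ?thesis using ge[OF that(2)] pos by linarith
  qed
  then show ?thesis using ge by auto
qed

end
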